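(* For $n,k\ge 1$ let $p_*(n,k)$ be the number of permutations in $S_n$ of genus one having $k$ cycles, and for $j=0,1,2$ let $p_j(n,k)$ be the number of permutations in $S_n$ of genus one having $k$ cycles and exactly $j$ back points. Let $P_*(x,y)=\sum_{n,k}p_*(n,k)x^ny^k$ and $P_j(x,y)=\sum_{n,k}p_j(n,k)x^ny^k$. Then, writing $\Delta=1-2(1+y)x+x^2(1-y)^2$, $$P_*(x,y)=\frac{x^3y}{\Delta^{5/2}},\quad P_0(x,y)=\frac{x^4y^2}{\Delta^{5/2}},\quad P_2(x,y)=\frac{x^4y}{\Delta^{5/2}},\quad P_1(x,y)=\frac{x^3y(1-xy-x)}{\Delta^{5/2}}.$$
   Context: For $n\ge 1$ let $\zeta_n\in S_n$ be the cyclic permutation $\zeta_n(i)=i+1$ for $i<n$, $\zeta_n(n)=1$. Permutations are composed right to left, and $z(\pi)$ denotes the number of cycles of $\pi$ (fixed points included). The genus $g(\alpha)$ of $\alpha\in S_n$ is the non-negative integer defined by $n+1-2g(\alpha)=z(\alpha)+z(\alpha^{-1}\zeta_n)$. An element $i\in\{1,\dots,n\}$ is a back point of $\alpha$ if $\alpha(i)<i$ and $\alpha(i)$ is not the smallest element of its cycle of $\alpha$. *)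

theory Defs
  imports "HOL-Combinatorics.Combinatorics" "HOL-Computational_Algebra.Formal_Power_Series"
begin

definition zeta_perm :: "nat \<Rightarrow> nat \<Rightarrow> nat" where
  "zeta_perm n i = (if i \<in> {1..n} then (if i = n then 1 else i + 1) else i)"

text \<open>
  Elements of \<open>S\<^sub>n\<close> are functions \<open>\<alpha>\<close> with \<open>\<alpha> permutes {1..n}\<close>. The cycles of such an \<open>\<alpha>\<close> are
  its orbits on \<open>{1..n}\<close>; a fixed point \<open>i\<close> contributes the orbit \<open>{i}\<close>.
\<close>

definition num_cycles :: "nat \<Rightarrow> (nat \<Rightarrow> nat) \<Rightarrow> nat" where
  "num_cycles n \<alpha> = card (orbit \<alpha> ` {1..n})"

text \<open>
  The defining equation determines \<open>g\<close>, so the genus is given as a functional relation; the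
  equation is stated over the integers to avoid truncated subtraction.
\<close>

definition has_genus :: "nat \<Rightarrow> (nat \<Rightarrow> nat) \<Rightarrow> nat \<Rightarrow> bool" where
  "has_genus n \<alpha> g \<longleftrightarrow>
     int n + 1 - 2 * int g = int (num_cycles n \<alpha>) + int (num_cycles n (inv \<alpha> \<circ> zeta_perm n))"

definition back_points :: "nat \<Rightarrow> (nat \<Rightarrow> nat) \<Rightarrow> nat set" where
  "back_points n \<alpha> = {i \<in> {1..n}. \<alpha> i < i \<and> \<alpha> i \<noteq> Min (orbit \<alpha> i)}"

definition p_star :: "nat \<Rightarrow> nat \<Rightarrow> nat" where
  "p_star n k = card {\<alpha>. \<alpha> permutes {1..n} \<and> has_genus n \<alpha> 1 \<and> num_cycles n \<alpha> = k}"

definition p_back :: "nat \<Rightarrow> nat \<Rightarrow> nat \<Rightarrow> nat" where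
  "p_back j n k = card {\<alpha>. \<alpha> permutes {1..n} \<and> has_genus n \<alpha> 1 \<and> num_cycles n \<alpha> = k \<and>
     card (back_points n \<alpha>) = j}"

text \<open>
  A power series in \<open>x\<close> and \<open>y\<close> is a power series in \<open>x\<close> whose coefficients are power series
  in \<open>y\<close>.
\<close>

definition var_x :: "rat fps fps" where
  "var_x = fps_X"

definition var_y :: "rat fps fps" where
  "var_y = fps_const fps_X"

definition bivariate_gf :: "(nat \<Rightarrow> nat \<Rightarrow> nat) \<Rightarrow> rat fps fps" where
  "bivariate_gf p = Abs_fps (\<lambda>n. Abs_fps (\<lambda>k. if n \<ge> 1 \<and> k \<ge> 1 then of_nat (p n k) else 0))"

definition Delta :: "rat fps fps" where
  "Delta = 1 - 2 * (1 + var_y) * var_x + var_x ^ 2 * (1 - var_y) ^ 2"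

text \<open>
  For \<open>F\<close> with constant term \<open>1\<close> (as a series in \<open>x\<close>), \<open>F\<^sup>a\<close> is the binomial series
  \<open>\<Sum>m. (a gchoose m) * (F - 1) ^ m\<close>. The coefficients of \<^const>\<open>fps_binomial\<close> are rational
  and have to be embedded as constants into the series in \<open>y\<close>.
\<close>

definition fps_rat_power :: "rat fps fps \<Rightarrow> rat \<Rightarrow> rat fps fps" where
  "fps_rat_power F a = fps_compose (Abs_fps (\<lambda>m. fps_const (fps_nth (fps_binomial a) m))) (F - 1)"

lemma fps_rat_power_add:
  assumes "fps_nth F 0 = 1"
  shows "fps_rat_power F (a + b) = fps_rat_power F a * fps_rat_power F b"
proof -
  let ?B = "\<lambda>a. Abs_fps (\<lambda>m. fps_const (fps_nth (fps_binomial (a::rat)) m))"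
  have "?B (a + b) = ?B a * ?B b"
    by (rule fps_ext, rule fps_ext)
      (simp only: fps_binomial_add_mult fps_mult_nth fps_nth_Abs_fps fps_const_mult
        fps_sum_nth fps_nth_fps_const, simp add: if_distrib sum.If_cases)
  then show ?thesis
    using assms by (simp add: fps_rat_power_def fps_compose_mult_distrib)
qed

lemma fps_rat_power_1:
  assumes "fps_nth F 0 = 1"
  shows "fps_rat_power F 1 = F"
proof -
  have "Abs_fps (\<lambda>m. fps_const (fps_nth (fps_binomial (1::rat)) m)) = 1 + fps_X"
    by (rule fps_ext) (simp add: fps_binomial_1 fps_X_def)
  then show ?thesis
    using assms by (simp add: fps_rat_power_def fps_compose_add_distrib)
qed

end

theory Submission
  imports Defs "HOL-Computational_Algebra.Polynomial"
begin

text \<open>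
  A permutation of \<open>{1..n + 1}\<close> arises in exactly one way from a permutation \<open>\<alpha>\<close> of \<open>{1..n}\<close>, by
  making \<open>n + 1\<close> a fixed point or by inserting it right after some \<open>i\<close> into a cycle of \<open>\<alpha>\<close>. Call the
  cycles of \<open>\<phi> = \<alpha>\<^sup>-\<^sup>1\<zeta>\<^sub>n\<close> faces, and let \<open>c\<^sub>1, \<dots>, c\<^sub>s = n\<close> be the face of \<open>n\<close>, listed in the order of \<open>\<phi>\<close>.
  A new fixed point is appended to this list. Inserting after \<open>c\<^sub>t\<close> preserves the genus: the list
  becomes \<open>c\<^sub>1, \<dots>, c\<^sub>t\<^sub>-\<^sub>1, n + 1\<close>, and \<open>c\<^sub>t, \<dots>, c\<^sub>s\<close> is split off as a face of its own. Inserting after an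
  element of another face merges that face into the list and raises the genus by one. The number of
  back points grows by one exactly if \<open>\<alpha> i > i\<close>.

  Hence the generating function of the genus one descendants of \<open>\<alpha>\<close> depends on few data. Let \<open>z\<close> mark
  back points and let \<open>U = 1 + p\<close> be the power series root of \<open>x y U\<^sup>2 - (1 + x y - x) U + 1\<close>. In genus
  one the generating function is a constant times the product, over the elements of the list before
  \<open>n\<close>, of \<open>1 + z p\<close> where \<open>\<alpha> i > i\<close> and \<open>U\<close> elsewhere. In genus zero the list contains no \<open>i\<close> with
  \<open>\<alpha> i > i\<close>, while every other face contains exactly one, and the generating function has the shape
  \<open>Q s + \<rho> s * (\<Sum>c. face_weight c)\<close> with \<open>c\<close> ranging over the other faces, where \<open>\<rho> s / U ^ s\<close> and
  \<open>Q s / U ^ s\<close> are polynomials in \<open>s\<close> of degree one and four. The theorem is the value for the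
  permutation of \<open>{1}\<close>.
\<close>

section \<open>Cycles as lists\<close>

text \<open>A list rather than a set, because an insertion cuts or joins faces at a position;
  checking a proposed cycle becomes a computation with \<open>map\<close> and
  \<open>rotate1\<close>.\<close>

definition is_cycle :: "('a \<Rightarrow> 'a) \<Rightarrow> 'a list \<Rightarrow> bool" where
  "is_cycle f xs \<longleftrightarrow> xs \<noteq> [] \<and> distinct xs \<and> map f xs = rotate1 xs"

lemma is_cycle_orbit:
  assumes "is_cycle f xs" "x \<in> set xs"
  shows "orbit f x = set xs"
proof
  have closed: "f y \<in> set xs" if "y \<in> set xs" for y
    using assms(1) that unfolding is_cycle_def by (metis image_eqI set_map set_rotate1)
  show "orbit f x \<subseteq> set xs"
  proof
    fix y assume "y \<in> orbit f x"
    then show "y \<in> set xs"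
      by induct (use assms(2) closed in auto)
  qed
  let ?n = "length xs"
  have step: "f (xs ! k) = xs ! (Suc k mod ?n)" if "k < ?n" for k
    using assms(1) that unfolding is_cycle_def by (metis nth_map nth_rotate1)
  obtain k where k: "k < ?n" "x = xs ! k"
    using assms(2) by (metis in_set_conv_nth)
  \<comment> \<open>\<open>orbit f x\<close> is generated from \<open>f x\<close>, not from
    \<open>x\<close>, hence the \<open>Suc j\<close>; \<open>x\<close> itself is reached only after
    a full turn.\<close>
  have reach: "xs ! ((k + Suc j) mod ?n) \<in> orbit f x" for j
  proof (induction j)
    case 0
    then show ?case
      using step[OF k(1)] k orbit.base[of f x] by simp
  next
    case (Suc j)
    have "(k + Suc j) mod ?n < ?n"
      using k by (intro mod_less_divisor) auto
    from step[OF this] Suc show ?case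
      using orbit.step[OF Suc] by (simp add: mod_Suc_eq)
  qed
  show "set xs \<subseteq> orbit f x"
  proof
    fix y assume "y \<in> set xs"
    then obtain l where l: "l < ?n" "y = xs ! l"
      by (metis in_set_conv_nth)
    \<comment> \<open>A full turn is added so that the subtraction does not truncate.\<close>
    have "(k + Suc (?n + l - Suc k)) mod ?n = l"
      using k l by (simp add: Suc_diff_Suc)
    then show "y \<in> orbit f x"
      using reach[of "?n + l - Suc k"] l by simp
  qed
qed

lemma is_cycle_rotate:
  assumes "is_cycle f (xs @ ys)"
  shows "is_cycle f (ys @ xs)"
proof -
  have "map f (rotate (length xs) (xs @ ys)) = rotate1 (rotate (length xs) (xs @ ys))"
    using assms unfolding is_cycle_def
    by (metis rotate_map rotate1_rotate_swap)
  then show ?thesis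
    using assms unfolding is_cycle_def by (auto simp: rotate_append)
qed

lemma is_cycle_exists:
  assumes "permutation p"
  obtains ys where "is_cycle p (x # ys)"
proof -
  let ?k = "least_power p x"
  have k: "?k > 0" "(p ^^ ?k) x = x"
    using least_power_of_permutation[OF assms] by auto
  have "is_cycle p (support p x)"
    unfolding is_cycle_def
  proof (intro conjI)
    show "support p x \<noteq> []" using k by simp
    show "distinct (support p x)" by (rule cycle_of_permutation[OF assms])
    show "map p (support p x) = rotate1 (support p x)"
    proof (rule nth_equalityI)
      fix i assume "i < length (map p (support p x))"
      then have i: "i < ?k" by simp
      show "map p (support p x) ! i = rotate1 (support p x) ! i"
      proof (cases "Suc i = ?k")
        case True
        then show ?thesis
          using i k by (simp add: nth_rotate1) (metis comp_apply funpow.simps(2))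
      next
        case False
        then show ?thesis using i by (simp add: nth_rotate1)
      qed
    qed simp
  qed
  moreover have "support p x = x # tl (support p x)"
    using k by (cases ?k) (auto simp: upt_conv_Cons simp del: upt_Suc)
  ultimately show thesis
    using that by metis
qed

definition other_cycles :: "('a \<Rightarrow> 'a) \<Rightarrow> 'a set \<Rightarrow> 'a \<Rightarrow> 'a set set" where
  "other_cycles f A x = orbit f ` (A - orbit f x)"

lemma orbit_eq_of_mem:
  assumes "permutation p" "y \<in> orbit p x"
  shows "orbit p y = orbit p x"
  using assms by (metis cyclic_on_orbit' orbit_cyclic_eq3)

lemma num_cycles_other_cycles:
  assumes "p permutes {1..n}" "x \<in> {1..n}"
  shows "num_cycles n p = Suc (card (other_cycles p {1..n} x))"
proof -
  have perm: "permutation p"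
    using assms by (auto simp: permutation_permutes)
  have sub: "orbit p x \<subseteq> {1..n}"
    using assms by (rule permutes_orbit_subset)
  have "orbit p ` {1..n} = insert (orbit p x) (other_cycles p {1..n} x)"
    using assms(2) orbit_eq_of_mem[OF perm] unfolding other_cycles_def by blast
  moreover have "orbit p x \<notin> other_cycles p {1..n} x"
    unfolding other_cycles_def using permutation_self_in_orbit[OF perm] by blast
  ultimately show ?thesis
    unfolding num_cycles_def by (simp add: other_cycles_def)
qed

lemma orbit_image_cong:
  assumes "permutation p" "\<And>x. x \<in> A \<Longrightarrow> orbit p x \<subseteq> A" "\<And>x. x \<in> A \<Longrightarrow> p x = q x"
  shows "orbit p ` A = orbit q ` A"
proof (rule image_cong[OF refl])
  fix x assume "x \<in> A"
  then show "orbit p x = orbit q x"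
    by (rule orbit_cong0) (use assms orbit.base in fastforce)+
qed

lemma orbit_subset_Diff:
  assumes "p permutes A" "finite A" "x \<in> A - orbit p y"
  shows "orbit p x \<subseteq> A - orbit p y"
proof -
  have perm: "permutation p"
    using assms by (auto simp: permutation_permutes)
  have "orbit p x \<subseteq> A"
    using assms by (intro permutes_orbit_subset) auto
  moreover have "x \<in> orbit p y" if "z \<in> orbit p x" "z \<in> orbit p y" for z
    using that orbit_eq_of_mem[OF perm] permutation_self_in_orbit[OF perm] by metis
  ultimately show ?thesis using assms by blast
qed

section \<open>Inserting a new largest element\<close>

text \<open>
  For \<open>i = n + 1\<close> the transposition is the identity, and \<open>n + 1\<close> becomes a fixed point.
\<close>

definition insert_after :: "nat \<Rightarrow> nat \<Rightarrow> (nat \<Rightarrow> nat) \<Rightarrow> nat \<Rightarrow> nat" where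
  "insert_after n i \<alpha> = \<alpha> \<circ> transpose i (Suc n)"

definition face_perm :: "nat \<Rightarrow> (nat \<Rightarrow> nat) \<Rightarrow> nat \<Rightarrow> nat" where
  "face_perm n \<alpha> = inv \<alpha> \<circ> zeta_perm n"

lemma zeta_perm_permutes: "zeta_perm n permutes {1..n}"
proof (rule bij_imp_permutes)
  have "zeta_perm n ` {1..n} = {1..n}"
  proof (intro equalityI subsetI)
    fix x assume "x \<in> {1..n}"
    then show "x \<in> zeta_perm n ` {1..n}"
      by (intro image_eqI[of _ _ "if x = 1 then n else x - 1"]) (auto simp: zeta_perm_def)
  qed (auto simp: zeta_perm_def)
  then show "bij_betw (zeta_perm n) {1..n} {1..n}"
    by (simp add: bij_betw_def eq_card_imp_inj_on)
qed (auto simp: zeta_perm_def)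

lemma face_perm_permutes: "\<alpha> permutes {1..n} \<Longrightarrow> face_perm n \<alpha> permutes {1..n}"
  unfolding face_perm_def
  by (intro permutes_compose zeta_perm_permutes permutes_inv)

lemma insert_after_permutes:
  assumes "\<alpha> permutes {1..n}" "i \<in> {1..Suc n}"
  shows "insert_after n i \<alpha> permutes {1..Suc n}"
  unfolding insert_after_def
proof (rule permutes_compose)
  show "transpose i (Suc n) permutes {1..Suc n}"
    using assms by (intro permutes_swap_id) auto
  show "\<alpha> permutes {1..Suc n}"
    by (rule permutes_subset[OF assms(1)]) auto
qed

text \<open>The decomposition \<open>sum_over_permutations_insert\<close> multiplies by the
  transposition on the left, whereas \<open>insert_after\<close> multiplies on the right; passing to
  inverses exchanges the sides.\<close>

lemma sum_permutes_insert_after: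
  fixes f :: "(nat \<Rightarrow> nat) \<Rightarrow> 'b::comm_monoid_add"
  shows "sum f {\<alpha>. \<alpha> permutes {1..Suc n}}
    = (\<Sum>\<alpha> | \<alpha> permutes {1..n}. \<Sum>i\<in>{1..Suc n}. f (insert_after n i \<alpha>))"
proof -
  have ins: "{1..Suc n} = insert (Suc n) {1..n}" by auto
  have inv: "inv (transpose (Suc n) b \<circ> q) = insert_after n b (inv q)"
    if "q permutes {1..n}" for b q
    using permutes_bij[OF that]
    by (simp add: o_inv_distrib insert_after_def transpose_commute[of _ b])
  have "sum f {\<alpha>. \<alpha> permutes {1..Suc n}} = (\<Sum>p | p permutes {1..Suc n}. f (inv p))"
    by (rule sum_permutations_inverse)
  also have "\<dots> = (\<Sum>b\<in>{1..Suc n}. \<Sum>q | q permutes {1..n}. f (inv (transpose (Suc n) b \<circ> q)))"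
    unfolding ins by (rule sum_over_permutations_insert) auto
  also have "\<dots> = (\<Sum>b\<in>{1..Suc n}. \<Sum>q | q permutes {1..n}. f (insert_after n b (inv q)))"
    by (intro sum.cong refl) (simp add: inv)
  also have "\<dots> = (\<Sum>b\<in>{1..Suc n}. \<Sum>q | q permutes {1..n}. f (insert_after n b q))"
    by (intro sum.cong refl sum_permutations_inverse[symmetric])
  also have "\<dots> = (\<Sum>\<alpha> | \<alpha> permutes {1..n}. \<Sum>i\<in>{1..Suc n}. f (insert_after n i \<alpha>))"
    by (rule sum.swap)
  finally show ?thesis .
qed

context
  fixes n :: nat and \<alpha> :: "nat \<Rightarrow> nat"
  assumes \<alpha>: "\<alpha> permutes {1..n}" and n: "n \<ge> 1"
begin

lemma insert_after_simps:
  "x \<le> n \<Longrightarrow> x \<noteq> i \<Longrightarrow> insert_after n i \<alpha> x = \<alpha> x"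
  "insert_after n i \<alpha> i = Suc n"
  "insert_after n i \<alpha> (Suc n) = \<alpha> i"
  using permutes_not_in[OF \<alpha>, of "Suc n"] by (auto simp: insert_after_def)

text \<open>Inversion moves the transposition to the left of \<open>inv \<alpha>\<close>, and the
  new long cycle differs from the old one only at \<open>n\<close> and \<open>n + 1\<close>. So
  \<open>n + 1\<close> inherits the image of \<open>n\<close>, the image of \<open>n\<close> becomes
  \<open>i\<close>, and the old arrow into \<open>i\<close>, if any, is redirected to
  \<open>n + 1\<close>.\<close>

lemma face_perm_insert_after:
  assumes "i \<in> {1..Suc n}"
  shows "face_perm (Suc n) (insert_after n i \<alpha>) n = i"
    and "face_perm (Suc n) (insert_after n i \<alpha>) (Suc n)
      = (if face_perm n \<alpha> n = i then Suc n else face_perm n \<alpha> n)"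
    and "x \<in> {1..<n} \<Longrightarrow> face_perm (Suc n) (insert_after n i \<alpha>) x
      = (if face_perm n \<alpha> x = i then Suc n else face_perm n \<alpha> x)"
proof -
  have inv: "inv (insert_after n i \<alpha>) = transpose i (Suc n) \<circ> inv \<alpha>"
    using permutes_bij[OF \<alpha>] by (simp add: o_inv_distrib insert_after_def)
  have ran: "inv \<alpha> y \<in> {1..n} \<longleftrightarrow> y \<in> {1..n}" for y
    by (rule permutes_in_image[OF permutes_inv[OF \<alpha>]])
  have fix_Suc: "inv \<alpha> (Suc n) = Suc n"
    using permutes_not_in[OF permutes_inv[OF \<alpha>]] by simp
  show "face_perm (Suc n) (insert_after n i \<alpha>) n = i"
    using n by (simp add: face_perm_def inv zeta_perm_def fix_Suc)
  show "face_perm (Suc n) (insert_after n i \<alpha>) (Suc n)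
      = (if face_perm n \<alpha> n = i then Suc n else face_perm n \<alpha> n)"
    using n ran[of 1] by (auto simp: face_perm_def inv zeta_perm_def transpose_def)
  show "face_perm (Suc n) (insert_after n i \<alpha>) x
      = (if face_perm n \<alpha> x = i then Suc n else face_perm n \<alpha> x)" if "x \<in> {1..<n}"
    using that ran[of "Suc x"] by (auto simp: face_perm_def inv zeta_perm_def transpose_def)
qed

end

section \<open>Faces after an insertion\<close>

context
  fixes n :: nat and \<alpha> :: "nat \<Rightarrow> nat"
  assumes \<alpha>: "\<alpha> permutes {1..n}" and n: "n \<ge> 1"
begin

lemma face_perm_permutation: "permutation (face_perm n \<alpha>)"
  using face_perm_permutes[OF \<alpha>] by (auto simp: permutation_permutes)

lemma face_orbit_subset: "x \<in> {1..n} \<Longrightarrow> orbit (face_perm n \<alpha>) x \<subseteq> {1..n}"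
  by (rule permutes_orbit_subset[OF face_perm_permutes[OF \<alpha>]])

text \<open>The last fact is the cycle equation read from \<open>n\<close>; it yields the images of
  \<open>Suc n # v\<close> later, because \<open>Suc n\<close> inherits the image of
  \<open>n\<close>.\<close>

lemma face_cycle_facts:
  assumes "is_cycle (face_perm n \<alpha>) (v @ [n])"
  shows "set v = orbit (face_perm n \<alpha>) n - {n}" "set v \<subseteq> {1..<n}" "distinct v"
    "face_perm n \<alpha> n # map (face_perm n \<alpha>) v = v @ [n]"
proof -
  have o: "orbit (face_perm n \<alpha>) n = set (v @ [n])"
    by (rule is_cycle_orbit[OF assms]) simp
  have d: "distinct (v @ [n])"
    using assms by (simp add: is_cycle_def)
  show "set v = orbit (face_perm n \<alpha>) n - {n}" "distinct v"
    using o d by auto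
  then show "set v \<subseteq> {1..<n}"
    using face_orbit_subset[of n] n d by fastforce
  have "is_cycle (face_perm n \<alpha>) ([n] @ v)"
    using assms by (rule is_cycle_rotate)
  then show "face_perm n \<alpha> n # map (face_perm n \<alpha>) v = v @ [n]"
    by (simp add: is_cycle_def)
qed

lemma is_cycle_insert_fixed:
  assumes "is_cycle (face_perm n \<alpha>) (v @ [n])"
  shows "is_cycle (face_perm (Suc n) (insert_after n (Suc n) \<alpha>)) (v @ [n, Suc n])"
proof -
  note v = face_cycle_facts[OF assms]
  let ?b = "face_perm n \<alpha>" and ?b' = "face_perm (Suc n) (insert_after n (Suc n) \<alpha>)"
  have ran: "?b x \<noteq> Suc n" if "x \<in> {1..n}" for x
    using that permutes_in_image[OF face_perm_permutes[OF \<alpha>], of x] by auto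
  have "map ?b' v = map ?b v"
  proof (rule map_cong[OF refl])
    fix x assume "x \<in> set v"
    then have "x \<in> {1..<n}" using v(2) by blast
    then show "?b' x = ?b x"
      using face_perm_insert_after(3)[OF \<alpha> n, of "Suc n" x] ran[of x] by auto
  qed
  then have "map ?b' (Suc n # v @ [n]) = (?b n # map ?b v) @ [Suc n]"
    using ran[of n] n face_perm_insert_after(1,2)[OF \<alpha> n, of "Suc n"] by simp
  then have "map ?b' (Suc n # v @ [n]) = (v @ [n]) @ [Suc n]"
    by (simp only: v(4))
  moreover have "distinct (Suc n # v @ [n])"
    using v(2,3) by auto
  ultimately have "is_cycle ?b' ([Suc n] @ (v @ [n]))"
    by (simp add: is_cycle_def)
  then show ?thesis
    using is_cycle_rotate by fastforce
qed

text \<open>\<open>Suc n # v1\<close> has the images that \<open>n # v1\<close> had, with the final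
  \<open>i\<close> replaced by \<open>Suc n\<close>, so it closes up before reaching
  \<open>i\<close>. What remains ends in \<open>n\<close>, whose image is now
  \<open>i\<close>.\<close>

lemma is_cycle_insert_split:
  assumes "is_cycle (face_perm n \<alpha>) (v @ [n])" and split: "v @ [n] = v1 @ i # v2"
  shows "is_cycle (face_perm (Suc n) (insert_after n i \<alpha>)) (v1 @ [Suc n])"
    and "is_cycle (face_perm (Suc n) (insert_after n i \<alpha>)) (i # v2)"
proof -
  note v = face_cycle_facts[OF assms(1)]
  let ?b = "face_perm n \<alpha>" and ?b' = "face_perm (Suc n) (insert_after n i \<alpha>)"
  have d: "distinct (v1 @ i # v2)"
    using v split by (metis assms(1) is_cycle_def)
  have "i \<in> set (v @ [n])" using split by simp
  then have i: "i \<in> {1..Suc n}" "i \<le> n" using v(2) n by auto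
  note b' = face_perm_insert_after[OF \<alpha> n i(1)]
  let ?h = "\<lambda>y. if y = i then Suc n else y"
  have b'_v: "?b' x = ?h (?b x)" if "x \<in> set v" for x
    using that v(2) b'(3)[of x] by auto
  have set_v: "v1 @ i # v2 = butlast (v1 @ i # v2) @ [n]" "v = butlast (v1 @ i # v2)"
    by (metis split butlast_snoc)+
  have len: "length v1 \<le> length v"
    using arg_cong[OF split, of length] by simp
  have "take (length v1) (v @ [n]) = v1" using split by simp
  then have take_v: "take (length v1) v = v1" using len by simp
  then have sub1: "set v1 \<subseteq> set v" by (metis set_take_subset)
  have "take (Suc (length v1)) (?b n # map ?b v) = v1 @ [i]"
    using v(4) split by simp
  then have pre: "?b n # map ?b v1 = v1 @ [i]"
    using take_v by (simp add: take_map)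
  have "map ?b' (Suc n # v1) = map ?h (?b n # map ?b v1)"
    using b'_v sub1 b'(2) by auto
  also have "\<dots> = map ?h v1 @ [Suc n]"
    by (simp only: pre) simp
  also have "map ?h v1 = v1"
    using d by (intro map_idI) auto
  finally have "map ?b' (Suc n # v1) = v1 @ [Suc n]" .
  moreover have "distinct (Suc n # v1)"
    using d sub1 v(2) by auto
  ultimately have "is_cycle ?b' ([Suc n] @ v1)"
    by (simp add: is_cycle_def)
  then show "is_cycle ?b' (v1 @ [Suc n])"
    by (rule is_cycle_rotate)
  show "is_cycle ?b' (i # v2)"
  proof (cases v2 rule: rev_cases)
    case Nil
    then have "i = n" using split by simp
    then show ?thesis
      using b'(1) Nil by (simp add: is_cycle_def)
  next
    case (snoc w k)
    then have w: "v2 = w @ [n]" "v = v1 @ i # w"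
      using split by auto
    have "length (?b n # map ?b v1) = length (v1 @ [i])"
      by simp
    moreover have "(?b n # map ?b v1) @ map ?b (i # w) = (v1 @ [i]) @ v2"
      using v(4) w by simp
    ultimately have "map ?b (i # w) = v2"
      by (metis append_eq_append_conv)
    moreover have "map ?b' (i # w) = map ?h (map ?b (i # w))"
      using b'_v w by auto
    moreover have "map ?h v2 = v2"
      using d by (intro map_idI) auto
    ultimately have "map ?b' (i # w) = v2"
      by metis
    then have "map ?b' (i # v2) = v2 @ [i]"
      using w b'(1) by simp
    then show ?thesis
      using d by (simp add: is_cycle_def)
  qed
qed

text \<open>\<open>n\<close> now points to \<open>i\<close>, and the predecessor of \<open>i\<close>
  points to \<open>Suc n\<close>; the face of \<open>i\<close>, opened in front of \<open>i\<close>,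
  is spliced in between \<open>n\<close> and \<open>Suc n\<close>.\<close>

lemma is_cycle_insert_merge:
  assumes "is_cycle (face_perm n \<alpha>) (v @ [n])" and D: "is_cycle (face_perm n \<alpha>) (i # d)"
    and i: "i \<in> {1..n}" "i \<notin> set (v @ [n])"
  shows "is_cycle (face_perm (Suc n) (insert_after n i \<alpha>)) (v @ [n] @ (i # d) @ [Suc n])"
proof -
  note v = face_cycle_facts[OF assms(1)]
  let ?b = "face_perm n \<alpha>" and ?b' = "face_perm (Suc n) (insert_after n i \<alpha>)"
  have iS: "i \<in> {1..Suc n}" using i by auto
  note b' = face_perm_insert_after[OF \<alpha> n iS]
  let ?h = "\<lambda>y. if y = i then Suc n else y"
  have oi: "orbit ?b i = set (i # d)"
    by (rule is_cycle_orbit[OF D]) simp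
  have on: "orbit ?b n = set (v @ [n])"
    by (rule is_cycle_orbit[OF assms(1)]) simp
  have disj: "set (i # d) \<inter> set (v @ [n]) = {}"
    using i(2) unfolding oi[symmetric] on[symmetric]
    using orbit_eq_of_mem[OF face_perm_permutation]
      permutation_self_in_orbit[OF face_perm_permutation] by blast
  have sub: "set (i # d) \<subseteq> {1..n}"
    unfolding oi[symmetric] using i(1) by (rule face_orbit_subset)
  have b'_h: "?b' x = ?h (?b x)" if "x \<in> set (v @ i # d)" for x
  proof -
    have "x \<in> {1..<n}" using that sub disj v(2) by fastforce
    then show ?thesis using b'(3)[of x] by auto
  qed
  have "map ?b' (Suc n # v) = map ?h (?b n # map ?b v)"
    using b'_h b'(2) by auto
  also have "\<dots> = map ?h (v @ [n])"
    by (simp only: v(4))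
  also have "\<dots> = v @ [n]"
    using i(2) by (intro map_idI) auto
  finally have 1: "map ?b' (Suc n # v) = v @ [n]" .
  have "map ?b' (i # d) = map ?h (map ?b (i # d))"
    using b'_h by auto
  also have "map ?b (i # d) = d @ [i]"
    using D by (simp add: is_cycle_def)
  also have "map ?h (d @ [i]) = d @ [Suc n]"
    using D by (auto simp: is_cycle_def intro!: map_idI)
  finally have 2: "map ?b' (i # d) = d @ [Suc n]" .
  have "map ?b' ((Suc n # v) @ [n] @ (i # d)) = (v @ [n] @ (i # d)) @ [Suc n]"
    using 1 2 b'(1) by simp
  moreover have "distinct (Suc n # v @ [n] @ (i # d))"
    using disj sub v(2,3) D by (auto simp: is_cycle_def)
  ultimately have "is_cycle ?b' ([Suc n] @ (v @ [n] @ (i # d)))"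
    by (simp add: is_cycle_def)
  then show ?thesis
    using is_cycle_rotate by fastforce
qed

lemma face_orbit_image_insert:
  assumes "i \<in> {1..Suc n}" "A \<subseteq> {1..<n}" "i \<notin> A"
    and closed: "\<And>x. x \<in> A \<Longrightarrow> orbit (face_perm n \<alpha>) x \<subseteq> A"
  shows "orbit (face_perm (Suc n) (insert_after n i \<alpha>)) ` A = orbit (face_perm n \<alpha>) ` A"
proof (rule orbit_image_cong[symmetric, OF face_perm_permutation closed])
  fix x assume x: "x \<in> A"
  then have "face_perm n \<alpha> x \<in> A"
    using closed orbit.base by fastforce
  then show "face_perm n \<alpha> x = face_perm (Suc n) (insert_after n i \<alpha>) x"
    using face_perm_insert_after(3)[OF \<alpha> n assms(1), of x] x assms(2,3) by auto
qed

lemma face_complement: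
  "{1..n} - orbit (face_perm n \<alpha>) n \<subseteq> {1..<n}"
  using permutation_self_in_orbit[OF face_perm_permutation, of n] by (auto simp: le_less)

lemma other_cycles_insert_fixed:
  assumes "is_cycle (face_perm n \<alpha>) (v @ [n])"
  shows "other_cycles (face_perm (Suc n) (insert_after n (Suc n) \<alpha>)) {1..Suc n} (Suc n)
    = other_cycles (face_perm n \<alpha>) {1..n} n"
proof -
  have o: "orbit (face_perm n \<alpha>) n = set (v @ [n])"
    by (rule is_cycle_orbit[OF assms]) simp
  have o': "orbit (face_perm (Suc n) (insert_after n (Suc n) \<alpha>)) (Suc n) = set (v @ [n, Suc n])"
    by (rule is_cycle_orbit[OF is_cycle_insert_fixed[OF assms]]) simp
  have eq: "{1..Suc n} - set (v @ [n, Suc n]) = {1..n} - orbit (face_perm n \<alpha>) n"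
    unfolding o using n by auto
  show ?thesis
    unfolding other_cycles_def o' eq using face_complement
    by (intro face_orbit_image_insert orbit_subset_Diff[OF face_perm_permutes[OF \<alpha>]]) auto
qed

lemma other_cycles_insert_split:
  assumes "is_cycle (face_perm n \<alpha>) (v @ [n])" and split: "v @ [n] = v1 @ i # v2"
  shows "other_cycles (face_perm (Suc n) (insert_after n i \<alpha>)) {1..Suc n} (Suc n)
    = insert (set (i # v2)) (other_cycles (face_perm n \<alpha>) {1..n} n)"
    and "set (i # v2) \<notin> other_cycles (face_perm n \<alpha>) {1..n} n"
proof -
  let ?b' = "face_perm (Suc n) (insert_after n i \<alpha>)"
  note c = is_cycle_insert_split[OF assms]
  have o: "orbit (face_perm n \<alpha>) n = set (v1 @ i # v2)"
    unfolding split[symmetric] by (rule is_cycle_orbit[OF assms(1)]) simp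
  have o': "orbit ?b' (Suc n) = set (v1 @ [Suc n])"
    by (rule is_cycle_orbit[OF c(1)]) simp
  have sub: "set (v1 @ i # v2) \<subseteq> {1..n}"
    unfolding o[symmetric] using face_orbit_subset[of n] n by simp
  have "distinct (v1 @ i # v2)"
    using assms by (metis is_cycle_def)
  then have eq: "{1..Suc n} - set (v1 @ [Suc n])
      = set (i # v2) \<union> ({1..n} - orbit (face_perm n \<alpha>) n)"
    unfolding o using sub by auto
  have "orbit ?b' ` set (i # v2) = {set (i # v2)}"
    using is_cycle_orbit[OF c(2)] by auto
  moreover have "orbit ?b' ` ({1..n} - orbit (face_perm n \<alpha>) n)
      = other_cycles (face_perm n \<alpha>) {1..n} n"
    unfolding other_cycles_def using face_complement sub o
    by (intro face_orbit_image_insert orbit_subset_Diff[OF face_perm_permutes[OF \<alpha>]]) auto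
  ultimately show "other_cycles ?b' {1..Suc n} (Suc n)
      = insert (set (i # v2)) (other_cycles (face_perm n \<alpha>) {1..n} n)"
    unfolding other_cycles_def[of ?b'] o' eq image_Un by (metis insert_is_Un)
  \<comment> \<open>The piece split off lies in the old top face, which is disjoint from the other
    faces; hence the number of faces really grows.\<close>
  show "set (i # v2) \<notin> other_cycles (face_perm n \<alpha>) {1..n} n"
  proof
    assume "set (i # v2) \<in> other_cycles (face_perm n \<alpha>) {1..n} n"
    then obtain x where "x \<in> {1..n} - orbit (face_perm n \<alpha>) n" "orbit (face_perm n \<alpha>) x = set (i # v2)"
      unfolding other_cycles_def by auto
    then show False
      using orbit_subset_Diff[OF face_perm_permutes[OF \<alpha>], of x n] o by auto
  qed
qed

lemma other_cycles_insert_merge: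
  assumes "is_cycle (face_perm n \<alpha>) (v @ [n])"
    and i: "i \<in> {1..n} - orbit (face_perm n \<alpha>) n"
  shows "orbit (face_perm (Suc n) (insert_after n i \<alpha>)) (Suc n)
      = insert (Suc n) (orbit (face_perm n \<alpha>) n \<union> orbit (face_perm n \<alpha>) i)"
    and "other_cycles (face_perm (Suc n) (insert_after n i \<alpha>)) {1..Suc n} (Suc n)
      = other_cycles (face_perm n \<alpha>) {1..n} n - {orbit (face_perm n \<alpha>) i}"
proof -
  let ?b = "face_perm n \<alpha>" and ?b' = "face_perm (Suc n) (insert_after n i \<alpha>)"
  obtain d where d: "is_cycle ?b (i # d)"
    using is_cycle_exists[OF face_perm_permutation] by blast
  have o: "orbit ?b n = set (v @ [n])"
    by (rule is_cycle_orbit[OF assms(1)]) simp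
  have oi: "orbit ?b i = set (i # d)"
    by (rule is_cycle_orbit[OF d]) simp
  have "i \<in> {1..n}" "i \<notin> set (v @ [n])"
    using i unfolding o by auto
  note c = is_cycle_insert_merge[OF assms(1) d this]
  show o': "orbit ?b' (Suc n) = insert (Suc n) (orbit ?b n \<union> orbit ?b i)"
    unfolding o oi using is_cycle_orbit[OF c, of "Suc n"] by auto
  define A where "A = {1..n} - orbit ?b n - orbit ?b i"
  have eq: "{1..Suc n} - insert (Suc n) (orbit ?b n \<union> orbit ?b i) = A"
    unfolding A_def by auto
  have self: "x \<in> orbit ?b x" for x
    by (rule permutation_self_in_orbit[OF face_perm_permutation])
  have sub: "orbit ?b x \<subseteq> A" if "x \<in> A" for x
  proof -
    have "orbit ?b x \<subseteq> {1..n} - orbit ?b n" "orbit ?b x \<subseteq> {1..n} - orbit ?b i"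
      using that unfolding A_def
      by (intro orbit_subset_Diff[OF face_perm_permutes[OF \<alpha>]]; simp)+
    then show ?thesis unfolding A_def by blast
  qed
  have "orbit ?b' ` A = orbit ?b ` A"
    using face_complement i self[of i] sub
    by (intro face_orbit_image_insert) (auto simp: A_def)
  also have "\<dots> = other_cycles ?b {1..n} n - {orbit ?b i}"
    unfolding A_def other_cycles_def
    using self orbit_eq_of_mem[OF face_perm_permutation] by auto
  finally show "other_cycles ?b' {1..Suc n} (Suc n) = other_cycles ?b {1..n} n - {orbit ?b i}"
    unfolding other_cycles_def[of ?b'] o' eq .
qed

end

section \<open>Cycles and back points after an insertion\<close>

context
  fixes n :: nat and \<alpha> :: "nat \<Rightarrow> nat"
  assumes \<alpha>: "\<alpha> permutes {1..n}" and n: "n \<ge> 1"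
begin

lemma permutation_of_permutes: "permutation \<alpha>"
  using \<alpha> by (auto simp: permutation_permutes)

text \<open>If \<open>i # d\<close> lists the cycle of \<open>i\<close>, then
  \<open>i # Suc n # d\<close> is a cycle of the new permutation; on cycles avoiding
  \<open>i\<close> no value changes.\<close>

lemma orbit_insert_after:
  assumes i: "i \<in> {1..n}"
  shows "orbit (insert_after n i \<alpha>) (Suc n) = insert (Suc n) (orbit \<alpha> i)"
    and "x \<in> {1..n} \<Longrightarrow> orbit (insert_after n i \<alpha>) x
      = (if i \<in> orbit \<alpha> x then insert (Suc n) (orbit \<alpha> x) else orbit \<alpha> x)"
proof -
  let ?a = "insert_after n i \<alpha>"
  note a = insert_after_simps[OF \<alpha> n]
  obtain d where d: "is_cycle \<alpha> (i # d)"
    using is_cycle_exists[OF permutation_of_permutes] by blast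
  have oi: "orbit \<alpha> i = set (i # d)"
    by (rule is_cycle_orbit[OF d]) simp
  have sub: "set (i # d) \<subseteq> {1..n}"
    unfolding oi[symmetric] by (rule permutes_orbit_subset[OF \<alpha> i])
  have dist: "i \<notin> set d" "distinct d" "\<alpha> i # map \<alpha> d = d @ [i]"
    using d by (auto simp: is_cycle_def)
  have "map ?a d = map \<alpha> d"
    using sub dist(1) by (auto intro!: a(1))
  then have "map ?a (i # Suc n # d) = Suc n # (\<alpha> i # map \<alpha> d)"
    by (simp add: a(2,3))
  then have "is_cycle ?a (i # Suc n # d)"
    using dist sub unfolding dist(3) is_cycle_def by auto
  then have 1: "orbit ?a x = insert (Suc n) (orbit \<alpha> i)" if "x \<in> insert (Suc n) (orbit \<alpha> i)" for x
    using that is_cycle_orbit[of ?a "i # Suc n # d"] unfolding oi by auto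
  then show "orbit ?a (Suc n) = insert (Suc n) (orbit \<alpha> i)" by blast
  note self = permutation_self_in_orbit[OF permutation_of_permutes]
  show "orbit ?a x = (if i \<in> orbit \<alpha> x then insert (Suc n) (orbit \<alpha> x) else orbit \<alpha> x)"
    if x: "x \<in> {1..n}"
  proof (cases "i \<in> orbit \<alpha> x")
    case True
    then have "orbit \<alpha> i = orbit \<alpha> x"
      by (rule orbit_eq_of_mem[OF permutation_of_permutes])
    then show ?thesis using 1[of x] self[of x] True by simp
  next
    case False
    have "orbit ?a x = orbit \<alpha> x"
    proof (rule orbit_cong[OF self])
      fix y assume "y \<in> orbit \<alpha> x"
      then show "?a y = \<alpha> y"
        using False permutes_orbit_subset[OF \<alpha> x] by (intro a(1)) auto
    qed
    then show ?thesis using False by simp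
  qed
qed

lemma orbit_insert_fixed:
  "orbit (insert_after n (Suc n) \<alpha>) (Suc n) = {Suc n}"
  "x \<in> {1..n} \<Longrightarrow> orbit (insert_after n (Suc n) \<alpha>) x = orbit \<alpha> x"
proof -
  show "orbit (insert_after n (Suc n) \<alpha>) (Suc n) = {Suc n}"
    by (simp add: orbit_eq_singleton_iff insert_after_simps[OF \<alpha> n])
  have "insert_after n (Suc n) \<alpha> = \<alpha>"
    by (simp add: insert_after_def)
  then show "orbit (insert_after n (Suc n) \<alpha>) x = orbit \<alpha> x"
    by simp
qed

lemma num_cycles_insert_after:
  assumes i: "i \<in> {1..n}"
  shows "num_cycles (Suc n) (insert_after n i \<alpha>) = num_cycles n \<alpha>"
proof -
  let ?a = "insert_after n i \<alpha>"
  have o: "orbit ?a i = insert (Suc n) (orbit \<alpha> i)"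
    using orbit_insert_after(2)[OF i i] permutation_self_in_orbit[OF permutation_of_permutes]
    by simp
  have eq: "{1..Suc n} - insert (Suc n) (orbit \<alpha> i) = {1..n} - orbit \<alpha> i"
    by auto
  have "other_cycles ?a {1..Suc n} i = other_cycles \<alpha> {1..n} i"
    unfolding other_cycles_def o eq
  proof (rule image_cong[OF refl])
    fix x assume x: "x \<in> {1..n} - orbit \<alpha> i"
    then have "i \<notin> orbit \<alpha> x"
      using orbit_eq_of_mem[OF permutation_of_permutes]
        permutation_self_in_orbit[OF permutation_of_permutes] by fastforce
    then show "orbit ?a x = orbit \<alpha> x"
      using orbit_insert_after(2)[OF i, of x] x by simp
  qed
  then show ?thesis
    using num_cycles_other_cycles[OF \<alpha> i] i
      num_cycles_other_cycles[OF insert_after_permutes[OF \<alpha>, of i], of i] by simp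
qed

lemma num_cycles_insert_fixed:
  "num_cycles (Suc n) (insert_after n (Suc n) \<alpha>) = Suc (num_cycles n \<alpha>)"
proof -
  have "{1..Suc n} - {Suc n} = {1..n}" by auto
  then have "other_cycles (insert_after n (Suc n) \<alpha>) {1..Suc n} (Suc n) = orbit \<alpha> ` {1..n}"
    unfolding other_cycles_def orbit_insert_fixed
    using orbit_insert_fixed(2) by (metis (no_types, lifting) image_cong)
  then show ?thesis
    using num_cycles_other_cycles[OF insert_after_permutes[OF \<alpha>], of "Suc n" "Suc n"]
    by (simp add: num_cycles_def)
qed

lemma back_points_insert_fixed:
  "back_points (Suc n) (insert_after n (Suc n) \<alpha>) = back_points n \<alpha>"
proof -
  have "insert_after n (Suc n) \<alpha> = \<alpha>"
    by (simp add: insert_after_def)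
  then show ?thesis
    using permutes_not_in[OF \<alpha>, of "Suc n"] unfolding back_points_def
    by (auto simp: le_Suc_eq)
qed

lemma Min_orbit:
  assumes "x \<in> {1..n}"
  shows "finite (orbit \<alpha> x)" "orbit \<alpha> x \<noteq> {}" "orbit \<alpha> x \<subseteq> {1..n}"
    "Min (orbit \<alpha> x) \<le> x" "Min (insert (Suc n) (orbit \<alpha> x)) = Min (orbit \<alpha> x)"
proof -
  show sub: "orbit \<alpha> x \<subseteq> {1..n}"
    by (rule permutes_orbit_subset[OF \<alpha> assms])
  then show fin: "finite (orbit \<alpha> x)"
    using finite_subset by blast
  show ne: "orbit \<alpha> x \<noteq> {}"
    by (rule orbit_nonempty)
  show le: "Min (orbit \<alpha> x) \<le> x"
    using permutation_self_in_orbit[OF permutation_of_permutes] fin by (intro Min_le)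
  then show "Min (insert (Suc n) (orbit \<alpha> x)) = Min (orbit \<alpha> x)"
    using assms fin ne by simp
qed

text \<open>
  If \<open>i\<close> is a back point, then \<open>n + 1\<close> takes its place; otherwise \<open>n + 1\<close> can only be a back point
  if \<open>\<alpha> i\<close> is not the minimum of its cycle, which then means \<open>\<alpha> i > i\<close>.
\<close>

lemma card_back_points_insert_after:
  assumes i: "i \<in> {1..n}"
  shows "card (back_points (Suc n) (insert_after n i \<alpha>))
    = card (back_points n \<alpha>) + (if \<alpha> i > i then 1 else 0)"
proof -
  let ?a = "insert_after n i \<alpha>" and ?B = "back_points n \<alpha>"
  note a = insert_after_simps[OF \<alpha> n]
  have ai: "\<alpha> i \<in> {1..n}"
    using permutes_in_image[OF \<alpha>] i by simp
  have min_x: "Min (orbit ?a x) = Min (orbit \<alpha> x)" if "x \<in> {1..n}" for x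
    using Min_orbit(5)[OF that] orbit_insert_after(2)[OF i that] by auto
  have min_m: "Min (orbit ?a (Suc n)) = Min (orbit \<alpha> i)"
    using Min_orbit(5)[OF i] orbit_insert_after(1)[OF i] by simp
  have "x \<in> back_points (Suc n) ?a \<longleftrightarrow>
      x \<in> (if \<alpha> i \<noteq> Min (orbit \<alpha> i) then insert (Suc n) (?B - {i}) else ?B - {i})" for x
  proof -
    consider "x = i" | "x = Suc n" | "x \<in> {1..n}" "x \<noteq> i" | "x \<notin> {1..Suc n}"
      by force
    then show ?thesis
    proof cases
      case 1
      then show ?thesis using a(2)[of i] i by (auto simp: back_points_def)
    next
      case 2
      then show ?thesis using a(3)[of i] ai min_m by (auto simp: back_points_def)
    next
      case 3
      then show ?thesis using a(1)[of x i] min_x[of x] by (auto simp: back_points_def)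
    qed (auto simp: back_points_def)
  qed
  then have eq: "back_points (Suc n) ?a
      = (if \<alpha> i \<noteq> Min (orbit \<alpha> i) then insert (Suc n) (?B - {i}) else ?B - {i})"
    by blast
  have fin: "finite ?B" "Suc n \<notin> ?B"
    by (auto simp: back_points_def)
  \<comment> \<open>A fixed point is the minimum of its cycle, and a value above \<open>i\<close> is
    not the minimum because the cycle contains \<open>i\<close>; only a value below \<open>i\<close>
    leaves both possibilities open.\<close>
  have "\<alpha> i = i \<Longrightarrow> \<alpha> i = Min (orbit \<alpha> i)"
    using orbit_eq_singleton_iff[of \<alpha> i] by simp
  moreover have "\<alpha> i > i \<Longrightarrow> \<alpha> i \<noteq> Min (orbit \<alpha> i)"
    using Min_orbit(4)[OF i] by simp
  moreover have "i \<in> ?B \<longleftrightarrow> \<alpha> i < i \<and> \<alpha> i \<noteq> Min (orbit \<alpha> i)"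
    using i by (auto simp: back_points_def)
  ultimately show ?thesis
    unfolding eq using fin card_Suc_Diff1[OF fin(1), of i]
    by (cases "\<alpha> i" i rule: linorder_cases) auto
qed

end

section \<open>Genus\<close>

text \<open>
  The excess is twice the genus.
\<close>

definition excess :: "nat \<Rightarrow> (nat \<Rightarrow> nat) \<Rightarrow> int" where
  "excess n \<alpha> = int n + 1 - int (num_cycles n \<alpha>) - int (num_cycles n (face_perm n \<alpha>))"

lemma has_genus_one_iff: "has_genus n \<alpha> 1 \<longleftrightarrow> excess n \<alpha> = 2"
  by (auto simp: has_genus_def excess_def face_perm_def)

context
  fixes n :: nat and \<alpha> :: "nat \<Rightarrow> nat"
  assumes \<alpha>: "\<alpha> permutes {1..n}" and n: "n \<ge> 1"
begin

abbreviation (input) "top_face \<equiv> orbit (face_perm n \<alpha>) n"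
abbreviation (input) "other_faces \<equiv> other_cycles (face_perm n \<alpha>) {1..n} n"

lemma top_face_cycle:
  obtains v where "is_cycle (face_perm n \<alpha>) (v @ [n])" "set (v @ [n]) = top_face"
proof -
  obtain v where "is_cycle (face_perm n \<alpha>) ([n] @ v)"
    using is_cycle_exists[OF face_perm_permutation[OF \<alpha> n], of n] by auto
  then have "is_cycle (face_perm n \<alpha>) (v @ [n])"
    by (rule is_cycle_rotate)
  then show thesis
    using that is_cycle_orbit[of _ "v @ [n]" n] by simp
qed

lemma finite_other_faces: "finite other_faces"
  by (simp add: other_cycles_def)

lemma num_faces: "num_cycles n (face_perm n \<alpha>) = Suc (card other_faces)"
  using n by (intro num_cycles_other_cycles face_perm_permutes[OF \<alpha>]) simp

lemma num_faces_insert: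
  assumes "i \<in> {1..Suc n}"
  shows "num_cycles (Suc n) (face_perm (Suc n) (insert_after n i \<alpha>))
    = Suc (card (other_cycles (face_perm (Suc n) (insert_after n i \<alpha>)) {1..Suc n} (Suc n)))"
  by (intro num_cycles_other_cycles face_perm_permutes insert_after_permutes \<alpha> assms) simp

text \<open>Here the additional cycle compensates the growth of \<open>n\<close>; in a split the
  additional face does. In a merge a face is lost instead, which makes the excess grow by 2.\<close>

lemma excess_insert_fixed: "excess (Suc n) (insert_after n (Suc n) \<alpha>) = excess n \<alpha>"
proof -
  obtain v where "is_cycle (face_perm n \<alpha>) (v @ [n])" using top_face_cycle by metis
  from other_cycles_insert_fixed[OF \<alpha> n this] show ?thesis
    using num_faces num_faces_insert[of "Suc n"] num_cycles_insert_fixed[OF \<alpha> n]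
    by (simp add: excess_def)
qed

lemma top_face_subset: "top_face \<subseteq> {1..n}"
  using n by (intro face_orbit_subset[OF \<alpha> n]) simp

lemma excess_insert_split:
  assumes i: "i \<in> top_face"
  shows "excess (Suc n) (insert_after n i \<alpha>) = excess n \<alpha>"
proof -
  obtain v where v: "is_cycle (face_perm n \<alpha>) (v @ [n])" "set (v @ [n]) = top_face"
    using top_face_cycle by metis
  then obtain v1 v2 where split: "v @ [n] = v1 @ i # v2"
    using i by (metis split_list)
  have i': "i \<in> {1..n}" using i top_face_subset by blast
  note o = other_cycles_insert_split[OF \<alpha> n v(1) split]
  have "card (other_cycles (face_perm (Suc n) (insert_after n i \<alpha>)) {1..Suc n} (Suc n))
      = Suc (card other_faces)"
    by (simp only: o(1) card_insert_disjoint[OF finite_other_faces o(2)])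
  then show ?thesis
    using num_faces num_faces_insert[of i] num_cycles_insert_after[OF \<alpha> n i'] i'
    by (simp add: excess_def)
qed

lemma excess_insert_merge:
  assumes i: "i \<in> {1..n} - top_face"
  shows "excess (Suc n) (insert_after n i \<alpha>) = excess n \<alpha> + 2"
proof -
  obtain v where v: "is_cycle (face_perm n \<alpha>) (v @ [n])"
    using top_face_cycle by metis
  note o = other_cycles_insert_merge(2)[OF \<alpha> n v i]
  have "orbit (face_perm n \<alpha>) i \<in> other_faces"
    using i by (simp add: other_cycles_def)
  then have "card other_faces
      = Suc (card (other_cycles (face_perm (Suc n) (insert_after n i \<alpha>)) {1..Suc n} (Suc n)))"
    unfolding o using finite_other_faces by (metis card_Suc_Diff1)
  then show ?thesis
    using num_faces num_faces_insert[of i] num_cycles_insert_after[OF \<alpha> n, of i] i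
    by (simp add: excess_def)
qed

end

text \<open>
  The part of the structure of genus zero permutations that determines the weights of their descendants.
\<close>

definition noncrossing_like :: "nat \<Rightarrow> (nat \<Rightarrow> nat) \<Rightarrow> bool" where
  "noncrossing_like n \<alpha> \<longleftrightarrow> (\<forall>i\<in>orbit (face_perm n \<alpha>) n. \<alpha> i \<le> i) \<and>
    (\<forall>c\<in>other_cycles (face_perm n \<alpha>) {1..n} n. card {i \<in> c. i < \<alpha> i} = 1) \<and>
    card (back_points n \<alpha>) = 0"

lemma noncrossing_like_insert_fixed:
  assumes \<alpha>: "\<alpha> permutes {1..n}" and n: "n \<ge> 1" and "noncrossing_like n \<alpha>"
  shows "noncrossing_like (Suc n) (insert_after n (Suc n) \<alpha>)"
proof -
  obtain v where v: "is_cycle (face_perm n \<alpha>) (v @ [n])"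
    "set (v @ [n]) = orbit (face_perm n \<alpha>) n"
    using top_face_cycle[OF \<alpha> n] by metis
  have o: "orbit (face_perm (Suc n) (insert_after n (Suc n) \<alpha>)) (Suc n)
      = insert (Suc n) (orbit (face_perm n \<alpha>) n)"
    using is_cycle_orbit[OF is_cycle_insert_fixed[OF \<alpha> n v(1)], of "Suc n"] v(2) by auto
  have "insert_after n (Suc n) \<alpha> = \<alpha>" "\<alpha> (Suc n) = Suc n"
    using permutes_not_in[OF \<alpha>] by (auto simp: insert_after_def)
  then show ?thesis
    using assms(3) other_cycles_insert_fixed[OF \<alpha> n v(1)] back_points_insert_fixed[OF \<alpha> n]
    unfolding noncrossing_like_def o by simp
qed

text \<open>In the face split off, \<open>i\<close> becomes the only rise since its image is now
  \<open>n + 1\<close>. The image of \<open>n + 1\<close> is \<open>\<alpha> i \<le> i\<close>, so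
  the top face gets no rise and no back point is created.\<close>

lemma noncrossing_like_insert_split:
  assumes \<alpha>: "\<alpha> permutes {1..n}" and n: "n \<ge> 1" and nc: "noncrossing_like n \<alpha>"
    and i: "i \<in> orbit (face_perm n \<alpha>) n"
  shows "noncrossing_like (Suc n) (insert_after n i \<alpha>)"
proof -
  let ?a = "insert_after n i \<alpha>"
  obtain v where v: "is_cycle (face_perm n \<alpha>) (v @ [n])"
    "set (v @ [n]) = orbit (face_perm n \<alpha>) n"
    using top_face_cycle[OF \<alpha> n] by metis
  then obtain v1 v2 where split: "v @ [n] = v1 @ i # v2"
    using i by (metis split_list)
  have dist: "distinct (v1 @ i # v2)"
    using v(1) split by (metis is_cycle_def)
  have top: "orbit (face_perm n \<alpha>) n = set (v1 @ i # v2)"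
    using v(2) split by simp
  then have sub: "set (v1 @ i # v2) \<subseteq> {1..n}"
    using top_face_subset[OF \<alpha> n] by simp
  then have i': "i \<in> {1..n}" by simp
  have le: "\<alpha> j \<le> j" if "j \<in> set (v1 @ i # v2)" for j
    using nc that unfolding noncrossing_like_def top by blast
  note a = insert_after_simps[OF \<alpha> n]
  have a_eq: "?a j = \<alpha> j" if "j \<in> {1..n}" "j \<noteq> i" for j
    using that by (intro a(1)) auto
  have o: "orbit (face_perm (Suc n) ?a) (Suc n) = set (v1 @ [Suc n])"
    using is_cycle_orbit[OF is_cycle_insert_split(1)[OF \<alpha> n v(1) split]] by simp
  have 1: "\<forall>j\<in>orbit (face_perm (Suc n) ?a) (Suc n). ?a j \<le> j"
    unfolding o
  proof
    fix j assume "j \<in> set (v1 @ [Suc n])"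
    then consider "j \<in> set v1" | "j = Suc n" by auto
    then show "?a j \<le> j"
    proof cases
      case 1
      then have "?a j = \<alpha> j" using sub dist by (intro a_eq) auto
      then show ?thesis using le[of j] 1 by simp
    next
      case 2
      then show ?thesis using a(3)[of i] i' le[of i] by simp
    qed
  qed
  have "\<not> j < ?a j" if j: "j \<in> set v2" for j
  proof -
    have "?a j = \<alpha> j" using sub dist j by (intro a_eq) auto
    then show ?thesis using le[of j] j by simp
  qed
  then have "{j \<in> set (i # v2). j < ?a j} = {i}"
    using a(2)[of i] i' by auto
  then have 2: "card {j \<in> set (i # v2). j < ?a j} = 1"
    by simp
  have 3: "card {j \<in> c. j < ?a j} = 1"
    if c: "c \<in> other_cycles (face_perm n \<alpha>) {1..n} n" for c
  proof -
    obtain x where "x \<in> {1..n} - orbit (face_perm n \<alpha>) n" "c = orbit (face_perm n \<alpha>) x"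
      using c unfolding other_cycles_def by auto
    then have "c \<subseteq> {1..n} - set (v1 @ i # v2)"
      using orbit_subset_Diff[OF face_perm_permutes[OF \<alpha>], of x n] unfolding top by simp
    then have "{j \<in> c. j < ?a j} = {j \<in> c. j < \<alpha> j}"
      using a_eq by fastforce
    then show ?thesis
      using nc c by (simp add: noncrossing_like_def)
  qed
  have 4: "card (back_points (Suc n) ?a) = 0"
    using card_back_points_insert_after[OF \<alpha> n i'] nc le[of i]
    by (simp add: noncrossing_like_def)
  show ?thesis
    unfolding noncrossing_like_def other_cycles_insert_split(1)[OF \<alpha> n v(1) split]
    using 1 2 3 4 by blast
qed

text \<open>The transposition is an involution, so inserting after the preimage of
  \<open>Suc n\<close> also undoes the insertion.\<close>

lemma permutes_Suc_cases:
  assumes "\<alpha>' permutes {1..Suc n}"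
  obtains \<alpha> i where "\<alpha> permutes {1..n}" "i \<in> {1..Suc n}" "\<alpha>' = insert_after n i \<alpha>"
proof -
  define i where "i = inv \<alpha>' (Suc n)"
  have i: "i \<in> {1..Suc n}"
    unfolding i_def using permutes_in_image[OF permutes_inv[OF assms]] by simp
  have a: "insert_after n i \<alpha>' permutes {1..Suc n}"
    unfolding insert_after_def using i
    by (intro permutes_compose permutes_swap_id assms) auto
  have "insert_after n i \<alpha>' (Suc n) = Suc n"
    using permutes_inverses[OF assms] by (simp add: insert_after_def i_def)
  then have "insert_after n i \<alpha>' permutes {1..n}"
    by (intro permutes_superset[OF a]) (auto simp: le_Suc_eq)
  moreover have "\<alpha>' = insert_after n i (insert_after n i \<alpha>')"
    by (simp add: insert_after_def fun_eq_iff)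
  ultimately show thesis
    using that i by blast
qed

lemma face_perm_one: "\<alpha> permutes {1..1} \<Longrightarrow> \<alpha> = id \<and> face_perm 1 \<alpha> = id"
  using face_perm_permutes[of \<alpha> 1] by (simp add: permutes_sing)

lemma excess_one:
  assumes "\<alpha> permutes {1..1}"
  shows "excess 1 \<alpha> = 0"
  using face_perm_one[OF assms] by (simp add: excess_def num_cycles_def)

text \<open>Every permutation is built up from that of {1} by insertions, which add 0 or 2 to the
  excess. Excess 0 is therefore reached only through new fixed points and splits, and these preserve
  \<open>noncrossing_like\<close>.\<close>

lemma excess_nonneg:
  assumes "\<alpha> permutes {1..n}" "n \<ge> 1"
  shows "excess n \<alpha> \<ge> 0 \<and> (excess n \<alpha> = 0 \<longrightarrow> noncrossing_like n \<alpha>)"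
  using assms(2,1)
proof (induction n arbitrary: \<alpha> rule: nat_induct_at_least)
  case base
  have f: "\<alpha> = id" "face_perm 1 \<alpha> = id"
    using face_perm_one[OF base] by auto
  have o: "orbit id (1::nat) = {1}"
    by (simp add: orbit_eq_singleton_iff)
  have "noncrossing_like 1 \<alpha>"
    unfolding noncrossing_like_def f(2) o other_cycles_def using f(1)
    by (simp add: back_points_def)
  then show ?case
    using excess_one[OF base] by simp
next
  case (Suc n \<alpha>')
  obtain \<alpha> i where a: "\<alpha> permutes {1..n}" "i \<in> {1..Suc n}" "\<alpha>' = insert_after n i \<alpha>"
    using permutes_Suc_cases[OF Suc.prems] by metis
  consider "i = Suc n" | "i \<in> orbit (face_perm n \<alpha>) n" | "i \<in> {1..n} - orbit (face_perm n \<alpha>) n"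
    using a(2) by force
  then show ?case
  proof cases
    case 1
    then show ?thesis
      using Suc.IH[OF a(1)] excess_insert_fixed[OF a(1) Suc.hyps]
        noncrossing_like_insert_fixed[OF a(1) Suc.hyps] a(3) by auto
  next
    case 2
    then show ?thesis
      using Suc.IH[OF a(1)] excess_insert_split[OF a(1) Suc.hyps]
        noncrossing_like_insert_split[OF a(1) Suc.hyps] a(3) by auto
  next
    case 3
    then show ?thesis
      using Suc.IH[OF a(1)] excess_insert_merge[OF a(1) Suc.hyps] a(3) by auto
  qed
qed

section \<open>Weights of descendants\<close>

lemma sum_set_conv_nth:
  fixes f :: "nat \<Rightarrow> 'b::comm_monoid_add"
  assumes "distinct xs"
  shows "sum f (set xs) = (\<Sum>t<length xs. f (xs ! t))"
  using sum.reindex_bij_betw[OF bij_betw_nth[OF assms refl refl], of f] by simp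

lemma sum_insertions:
  fixes f :: "nat \<Rightarrow> 'b::comm_monoid_add"
  assumes \<alpha>: "\<alpha> permutes {1..n}" and n: "n \<ge> 1" and v: "is_cycle (face_perm n \<alpha>) (v @ [n])"
  shows "(\<Sum>i\<in>{1..Suc n}. f i) = f (Suc n) + (\<Sum>t<Suc (length v). f ((v @ [n]) ! t))
    + (\<Sum>i\<in>{1..n} - orbit (face_perm n \<alpha>) n. f i)"
proof -
  have o: "orbit (face_perm n \<alpha>) n = set (v @ [n])"
    by (rule is_cycle_orbit[OF v]) simp
  have "(\<Sum>i\<in>{1..n}. f i) = (\<Sum>i\<in>{1..n} - orbit (face_perm n \<alpha>) n. f i)
      + (\<Sum>i\<in>orbit (face_perm n \<alpha>) n. f i)"
    by (intro sum.subset_diff top_face_subset \<alpha> n) simp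
  also have "(\<Sum>i\<in>orbit (face_perm n \<alpha>) n. f i) = (\<Sum>t<Suc (length v). f ((v @ [n]) ! t))"
    unfolding o using v sum_set_conv_nth[of "v @ [n]" f] by (simp add: is_cycle_def)
  finally show ?thesis
    by (simp add: ac_simps)
qed

text \<open>
  The face lengths \<open>s - t\<close> in \<open>Q_rec\<close> are those of the faces split off from a top face of length \<open>s\<close>.
  The inhomogeneous term of \<open>\<rho>_rec\<close> accounts for the merging of a face into the top face.
\<close>

locale genus_weights =
  fixes x y z p U C :: "'a::comm_ring_1" and \<rho> Q :: "nat \<Rightarrow> 'a"
  assumes U_def: "U = 1 + p"
    and kernel: "(1 - x - x * y * U) * p = x"
    and CU: "C * U * (1 - x - x * y * U) = 1"
    and \<rho>_rec: "s \<ge> 1 \<Longrightarrow>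
      \<rho> s = x * y * \<rho> (Suc s) + x * (\<Sum>t<s. \<rho> (Suc t)) + x * C * U ^ s"
    and Q_rec: "s \<ge> 1 \<Longrightarrow>
      Q s = x * y * Q (Suc s) + x * (\<Sum>t<s. Q (Suc t) + \<rho> (Suc t) *
        (z * (1 + z * p) * U ^ (s - t) + of_nat (s - t - 1) * (1 + z * p)^2 * U ^ (s - t - 1)))"
begin

text \<open>Sums the merges with a face of \<open>m\<close> elements that contains one rise.
  Inserting after the rise creates a back point and leaves \<open>m - 1\<close> factors
  \<open>U\<close>; after any other element there are two rises and \<open>m - 2\<close> factors
  \<open>U\<close>. One \<open>U\<close> of \<open>C * U\<close> is included, which avoids the
  exponent \<open>m - 2\<close>.\<close>

definition face_weight :: "nat \<Rightarrow> 'a" where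
  "face_weight m = z * (1 + z * p) * U ^ m + of_nat (m - 1) * (1 + z * p)^2 * U ^ (m - 1)"

definition step_weight :: "(nat \<Rightarrow> nat) \<Rightarrow> nat \<Rightarrow> 'a" where
  "step_weight \<alpha> i = (if i < \<alpha> i then 1 + z * p else U)"

definition rise_weight :: "(nat \<Rightarrow> nat) \<Rightarrow> nat \<Rightarrow> 'a" where
  "rise_weight \<alpha> i = (if i < \<alpha> i then z else 1)"

text \<open>
  The generating function of the genus one descendants of \<open>\<alpha>\<close>, where \<open>x\<close> marks the number of inserted
  elements; in excess above 2 there are none.
\<close>

definition potential :: "nat \<Rightarrow> (nat \<Rightarrow> nat) \<Rightarrow> 'a" where
  "potential n \<alpha> = (let \<phi> = face_perm n \<alpha> in
    if excess n \<alpha> = 2 then y ^ num_cycles n \<alpha> * z ^ card (back_points n \<alpha>) *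
      (C * U * (\<Prod>i\<in>orbit \<phi> n - {n}. step_weight \<alpha> i))
    else if excess n \<alpha> = 0 then y ^ num_cycles n \<alpha> * (Q (card (orbit \<phi> n)) +
      \<rho> (card (orbit \<phi> n)) * (\<Sum>c\<in>other_cycles \<phi> {1..n} n. face_weight (card c)))
    else 0)"

text \<open>
  The three products on the right belong to the insertion as a fixed point, after \<open>n\<close>, and after the
  entry \<open>v ! t\<close> of the top face.
\<close>

lemma word_weight_rec:
  fixes v :: "nat list"
  shows "C * U * prod_list (map (step_weight \<alpha>) v) =
    1 + x * y * U * (C * U * prod_list (map (step_weight \<alpha>) v)) +
    x * (C * U * prod_list (map (step_weight \<alpha>) v)) +
    x * (\<Sum>t<length v. rise_weight \<alpha> (v ! t) *
      (C * U * prod_list (map (step_weight \<alpha>) (take t v))))"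
proof (induction v rule: rev_induct)
  case Nil
  have "C * U = C * U * (1 - x - x * y * U) + x * y * U * (C * U) + x * (C * U)"
    by (simp add: algebra_simps)
  then show ?case unfolding CU by simp
next
  case (snoc a v)
  have step: "step_weight \<alpha> a = 1 + rise_weight \<alpha> a * p"
    unfolding step_weight_def rise_weight_def by (simp add: U_def)
  define W where "W = C * U * prod_list (map (step_weight \<alpha>) v)"
  define S where "S = x * (\<Sum>t<length v. rise_weight \<alpha> (v ! t) *
      (C * U * prod_list (map (step_weight \<alpha>) (take t v))))"
  have W: "W * (1 - x - x * y * U) = 1 + S"
    using snoc.IH unfolding W_def[symmetric] S_def[symmetric] by (simp add: algebra_simps)
  \<comment> \<open>The kernel equation turns the increment caused by the new entry \<open>a\<close>
    into the summand for an insertion after \<open>a\<close>.\<close>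
  have "W * (1 + rise_weight \<alpha> a * p) * (1 - x - x * y * U)
      = W * (1 - x - x * y * U) + rise_weight \<alpha> a * W * ((1 - x - x * y * U) * p)"
    by (simp add: algebra_simps)
  also have "\<dots> = 1 + S + x * (rise_weight \<alpha> a * W)"
    unfolding W kernel by (simp add: algebra_simps)
  finally have eq: "W * step_weight \<alpha> a * (1 - x - x * y * U) = 1 + S + x * (rise_weight \<alpha> a * W)"
    unfolding step .
  have "W * step_weight \<alpha> a = W * step_weight \<alpha> a * (1 - x - x * y * U)
      + x * y * U * (W * step_weight \<alpha> a) + x * (W * step_weight \<alpha> a)"
    by (simp add: algebra_simps)
  also have "\<dots> = 1 + x * y * U * (W * step_weight \<alpha> a)
      + x * (W * step_weight \<alpha> a) + (S + x * (rise_weight \<alpha> a * W))"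
    unfolding eq by (simp only: ac_simps)
  finally have *: "W * step_weight \<alpha> a = 1 + x * y * U * (W * step_weight \<alpha> a)
      + x * (W * step_weight \<alpha> a) + (S + x * (rise_weight \<alpha> a * W))" .
  have "(\<Sum>t<length (v @ [a]). rise_weight \<alpha> ((v @ [a]) ! t) *
      (C * U * prod_list (map (step_weight \<alpha>) (take t (v @ [a])))))
    = (\<Sum>t<length v. rise_weight \<alpha> (v ! t) *
      (C * U * prod_list (map (step_weight \<alpha>) (take t v)))) + rise_weight \<alpha> a * W"
    unfolding W_def by (simp add: nth_append)
  then have "x * (\<Sum>t<length (v @ [a]). rise_weight \<alpha> ((v @ [a]) ! t) *
      (C * U * prod_list (map (step_weight \<alpha>) (take t (v @ [a])))))
    = S + x * (rise_weight \<alpha> a * W)"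
    unfolding S_def by (simp add: distrib_left)
  moreover have "C * U * prod_list (map (step_weight \<alpha>) (v @ [a])) = W * step_weight \<alpha> a"
    by (simp add: W_def mult.assoc)
  ultimately show ?case
    using * by simp
qed

section \<open>The recurrence of the potential under insertion\<close>

lemma potential_rec_genus_one:
  assumes \<alpha>: "\<alpha> permutes {1..n}" and n: "n \<ge> 1" and e: "excess n \<alpha> = 2"
  shows "potential n \<alpha> = y ^ num_cycles n \<alpha> * z ^ card (back_points n \<alpha>)
    + x * (\<Sum>i\<in>{1..Suc n}. potential (Suc n) (insert_after n i \<alpha>))"
proof -
  obtain v where v: "is_cycle (face_perm n \<alpha>) (v @ [n])"
      "set (v @ [n]) = orbit (face_perm n \<alpha>) n"
    using top_face_cycle[OF \<alpha> n] by metis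
  note vf = face_cycle_facts[OF \<alpha> n v(1)]
  define M where "M = y ^ num_cycles n \<alpha> * z ^ card (back_points n \<alpha>)"
  define W where "W u = C * U * prod_list (map (step_weight \<alpha>) u)" for u
  note a = insert_after_simps[OF \<alpha> n]
  have an: "\<alpha> n \<le> n"
    using permutes_in_image[OF \<alpha>, of n] n by simp
  have step_eq: "step_weight (insert_after n i \<alpha>) j = step_weight \<alpha> j" if "j \<le> n" "j \<noteq> i" for i j
    using a(1)[OF that] by (simp add: step_weight_def)
  have pot: "potential n \<alpha> = M * W v"
    using e prod.distinct_set_conv_list[OF vf(3), of "step_weight \<alpha>"]
    by (simp add: potential_def M_def W_def vf(1)[symmetric])
  have fixed: "potential (Suc n) (insert_after n (Suc n) \<alpha>) = y * U * (M * W v)"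
  proof -
    have o: "orbit (face_perm (Suc n) (insert_after n (Suc n) \<alpha>)) (Suc n) - {Suc n} = set (v @ [n])"
      using is_cycle_orbit[OF is_cycle_insert_fixed[OF \<alpha> n v(1)], of "Suc n"] vf(2) by auto
    have "(\<Prod>j\<in>set (v @ [n]). step_weight (insert_after n (Suc n) \<alpha>) j)
        = (\<Prod>j\<in>set (v @ [n]). step_weight \<alpha> j)"
      using vf(2) by (intro prod.cong refl step_eq) auto
    also have "\<dots> = prod_list (map (step_weight \<alpha>) (v @ [n]))"
      using v(1) by (intro prod.distinct_set_conv_list) (simp add: is_cycle_def)
    \<comment> \<open>\<open>n\<close> is no longer last in the top face, so it acquires a step
      weight; it is not a rise, hence the factor \<open>U\<close>.\<close>
    also have "\<dots> = prod_list (map (step_weight \<alpha>) v) * U"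
      using an by (simp add: step_weight_def)
    finally have pr: "(\<Prod>j\<in>set (v @ [n]). step_weight (insert_after n (Suc n) \<alpha>) j)
        = prod_list (map (step_weight \<alpha>) v) * U" .
    show ?thesis
      unfolding potential_def Let_def o pr
      using e excess_insert_fixed[OF \<alpha> n] num_cycles_insert_fixed[OF \<alpha> n]
        back_points_insert_fixed[OF \<alpha> n]
      by (simp add: M_def W_def mult_ac)
  qed
  have split: "potential (Suc n) (insert_after n ((v @ [n]) ! t) \<alpha>)
      = M * (rise_weight \<alpha> ((v @ [n]) ! t) * W (take t v))" if t: "t < Suc (length v)" for t
  proof -
    define i where "i = (v @ [n]) ! t"
    have sp: "v @ [n] = take t v @ i # drop (Suc t) (v @ [n])"
      using id_take_nth_drop[of t "v @ [n]"] t by (simp add: i_def)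
    have mem: "i \<in> set (v @ [n])"
      using t unfolding i_def by (intro nth_mem) simp
    then have i: "i \<in> orbit (face_perm n \<alpha>) n" "i \<in> {1..n}"
      using v(2) top_face_subset[OF \<alpha> n] by auto
    have sub: "set (take t v) \<subseteq> {1..<n}"
      using vf(2) set_take_subset[of t v] by blast
    have o: "orbit (face_perm (Suc n) (insert_after n i \<alpha>)) (Suc n) - {Suc n} = set (take t v)"
      using is_cycle_orbit[OF is_cycle_insert_split(1)[OF \<alpha> n v(1) sp], of "Suc n"] sub by auto
    have "distinct (take t v @ i # drop (Suc t) (v @ [n]))"
      using v(1) sp unfolding is_cycle_def by metis
    \<comment> \<open>Of the old elements only \<open>i\<close> changes its image, and it leaves the
      top face.\<close>
    then have "i \<notin> set (take t v)" by simp
    then have "(\<Prod>j\<in>set (take t v). step_weight (insert_after n i \<alpha>) j)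
        = (\<Prod>j\<in>set (take t v). step_weight \<alpha> j)"
      using sub by (intro prod.cong refl step_eq) auto
    also have "\<dots> = prod_list (map (step_weight \<alpha>) (take t v))"
      using vf(3) by (intro prod.distinct_set_conv_list) simp
    finally have pr: "(\<Prod>j\<in>set (take t v). step_weight (insert_after n i \<alpha>) j)
        = prod_list (map (step_weight \<alpha>) (take t v))" .
    have "potential (Suc n) (insert_after n i \<alpha>) = M * (rise_weight \<alpha> i * W (take t v))"
      unfolding potential_def Let_def o pr
      using e excess_insert_split[OF \<alpha> n i(1)] num_cycles_insert_after[OF \<alpha> n i(2)]
        card_back_points_insert_after[OF \<alpha> n i(2)]
      by (simp add: M_def W_def rise_weight_def mult_ac)
    then show ?thesis by (simp add: i_def)
  qed
  have merge: "potential (Suc n) (insert_after n i \<alpha>) = 0"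
    if "i \<in> {1..n} - orbit (face_perm n \<alpha>) n" for i
    using e excess_insert_merge[OF \<alpha> n that] by (simp add: potential_def)
  have "(\<Sum>i\<in>{1..Suc n}. potential (Suc n) (insert_after n i \<alpha>))
      = y * U * (M * W v) + (\<Sum>t<Suc (length v). M * (rise_weight \<alpha> ((v @ [n]) ! t) * W (take t v)))"
    unfolding sum_insertions[OF \<alpha> n v(1)] using fixed split merge by simp
  \<comment> \<open>The term \<open>t = length v\<close> is the insertion after \<open>n\<close>,
    whose rise weight is 1.\<close>
  also have "(\<Sum>t<Suc (length v). M * (rise_weight \<alpha> ((v @ [n]) ! t) * W (take t v)))
      = M * (\<Sum>t<length v. rise_weight \<alpha> (v ! t) * W (take t v)) + M * W v"
    using an by (simp add: sum_distrib_left nth_append rise_weight_def)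
  finally have sum: "x * (\<Sum>i\<in>{1..Suc n}. potential (Suc n) (insert_after n i \<alpha>))
      = M * (x * y * U * W v + x * W v + x * (\<Sum>t<length v. rise_weight \<alpha> (v ! t) * W (take t v)))"
    by (simp add: algebra_simps)
  show ?thesis
    unfolding sum pot M_def[symmetric]
    using arg_cong[OF word_weight_rec[of \<alpha> v, folded W_def], of "\<lambda>q. M * q"]
    by (simp add: algebra_simps)
qed

text \<open>After the merge all of the old top face, \<open>n\<close> included, precedes the last
  entry and contains no rise, which gives the power of \<open>U\<close>. Splitting the sum over
  \<open>c\<close> into the unique rise \<open>r\<close> and the rest gives
  \<open>face_weight\<close>.\<close>

lemma potential_insert_merge:
  assumes \<alpha>: "\<alpha> permutes {1..n}" and n: "n \<ge> 1" and e: "excess n \<alpha> = 0"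
    and c: "c \<in> other_cycles (face_perm n \<alpha>) {1..n} n"
  shows "(\<Sum>i\<in>c. potential (Suc n) (insert_after n i \<alpha>)) =
    y ^ num_cycles n \<alpha> * (C * U ^ card (orbit (face_perm n \<alpha>) n) * face_weight (card c))"
proof -
  let ?o = "orbit (face_perm n \<alpha>) n"
  have nc: "noncrossing_like n \<alpha>"
    using excess_nonneg[OF \<alpha> n] e by simp
  note perm = face_perm_permutation[OF \<alpha> n]
  obtain k where k: "k \<in> {1..n} - ?o" "c = orbit (face_perm n \<alpha>) k"
    using c unfolding other_cycles_def by auto
  have c_sub: "c \<subseteq> {1..n} - ?o"
    unfolding k(2) by (intro orbit_subset_Diff[OF face_perm_permutes[OF \<alpha>]] k) simp
  then have fin: "finite c" using finite_subset by blast
  obtain v where v: "is_cycle (face_perm n \<alpha>) (v @ [n])"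
    using top_face_cycle[OF \<alpha> n] by metis
  note a = insert_after_simps[OF \<alpha> n]
  note top_sub = top_face_subset[OF \<alpha> n]
  have "card {i \<in> c. i < \<alpha> i} = 1"
    using nc c by (simp add: noncrossing_like_def)
  then obtain r where r: "{i \<in> c. i < \<alpha> i} = {r}"
    using card_1_singletonE by blast
  then have r_mem: "r \<in> c" "r < \<alpha> r" and r_only: "\<And>i. i \<in> c \<Longrightarrow> i \<noteq> r \<Longrightarrow> \<not> i < \<alpha> i"
    by blast+
  have step: "step_weight \<alpha> i = (if i = r then 1 + z * p else U)" if "i \<in> c" for i
    using r_mem r_only[OF that] by (auto simp: step_weight_def)
  define Y where "Y = y ^ num_cycles n \<alpha> * (C * U ^ Suc (card ?o))"
  have pot: "potential (Suc n) (insert_after n i \<alpha>)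
      = Y * (rise_weight \<alpha> i * (1 + z * p) * (\<Prod>j\<in>c - {i}. step_weight \<alpha> j))" if i: "i \<in> c" for i
  proof -
    let ?a = "insert_after n i \<alpha>"
    have i': "i \<in> {1..n} - ?o" "i \<in> {1..n}" using i c_sub by auto
    have ci: "orbit (face_perm n \<alpha>) i = c"
      using orbit_eq_of_mem[OF perm] i k(2) by metis
    have step_eq: "step_weight ?a j = step_weight \<alpha> j" if "j \<le> n" "j \<noteq> i" for j
      using a(1)[OF that] by (simp add: step_weight_def)
    have o: "orbit (face_perm (Suc n) ?a) (Suc n) - {Suc n} = ?o \<union> insert i (c - {i})"
      using other_cycles_insert_merge(1)[OF \<alpha> n v i'(1)] c_sub top_sub i unfolding ci by auto
    have "(\<Prod>j\<in>?o \<union> insert i (c - {i}). step_weight ?a j)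
        = (\<Prod>j\<in>?o. step_weight ?a j) * (step_weight ?a i * (\<Prod>j\<in>c - {i}. step_weight ?a j))"
      using c_sub i fin finite_subset[OF top_sub]
      by (subst prod.union_disjoint) (auto simp: prod.insert simp del: insert_Diff_single)
    also have "(\<Prod>j\<in>?o. step_weight ?a j) = (\<Prod>j\<in>?o. U)"
    proof (rule prod.cong[OF refl])
      fix j assume j: "j \<in> ?o"
      then have "step_weight ?a j = step_weight \<alpha> j"
        using top_sub i' by (intro step_eq) auto
      then show "step_weight ?a j = U"
        using nc j unfolding noncrossing_like_def step_weight_def
        by (metis linorder_not_le)
    qed
    also have "step_weight ?a i = 1 + z * p"
      using a(2)[of i] i' by (simp add: step_weight_def)
    also have "(\<Prod>j\<in>c - {i}. step_weight ?a j) = (\<Prod>j\<in>c - {i}. step_weight \<alpha> j)"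
      using c_sub by (intro prod.cong refl step_eq) auto
    finally have pr: "(\<Prod>j\<in>?o \<union> insert i (c - {i}). step_weight ?a j)
        = U ^ card ?o * ((1 + z * p) * (\<Prod>j\<in>c - {i}. step_weight \<alpha> j))"
      by simp
    have "z ^ card (back_points (Suc n) ?a) = rise_weight \<alpha> i"
      using card_back_points_insert_after[OF \<alpha> n i'(2)] nc
      by (simp add: noncrossing_like_def rise_weight_def)
    then show ?thesis
      unfolding potential_def Let_def o pr
      using e excess_insert_merge[OF \<alpha> n i'(1)] num_cycles_insert_after[OF \<alpha> n i'(2)]
      by (simp add: Y_def mult_ac)
  qed
  have card_c: "card (c - {r}) = card c - 1"
    using r_mem fin by simp
  have "(\<Sum>i\<in>c. potential (Suc n) (insert_after n i \<alpha>))
      = (\<Sum>i\<in>c. Y * (rise_weight \<alpha> i * (1 + z * p) * (\<Prod>j\<in>c - {i}. step_weight \<alpha> j)))"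
    by (intro sum.cong refl pot)
  also have "\<dots> = Y * (rise_weight \<alpha> r * (1 + z * p) * (\<Prod>j\<in>c - {r}. step_weight \<alpha> j))
      + (\<Sum>i\<in>c - {r}. Y * (rise_weight \<alpha> i * (1 + z * p) * (\<Prod>j\<in>c - {i}. step_weight \<alpha> j)))"
    by (rule sum.remove[OF fin r_mem(1)])
  also have "(\<Prod>j\<in>c - {r}. step_weight \<alpha> j) = (\<Prod>j\<in>c - {r}. U)"
    using step by (intro prod.cong refl) auto
  also have "\<dots> = U ^ (card c - 1)"
    using card_c by simp
  also have "(\<Sum>i\<in>c - {r}. Y * (rise_weight \<alpha> i * (1 + z * p) * (\<Prod>j\<in>c - {i}. step_weight \<alpha> j)))
      = (\<Sum>i\<in>c - {r}. Y * (1 + z * p)^2 * U ^ (card c - 2))"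
  proof (rule sum.cong[OF refl])
    fix i assume i: "i \<in> c - {r}"
    have "(\<Prod>j\<in>c - {i}. step_weight \<alpha> j)
        = step_weight \<alpha> r * (\<Prod>j\<in>c - {i} - {r}. step_weight \<alpha> j)"
      using i r_mem fin by (intro prod.remove) auto
    also have "(\<Prod>j\<in>c - {i} - {r}. step_weight \<alpha> j) = (\<Prod>j\<in>c - {i} - {r}. U)"
      using step by (intro prod.cong refl) auto
    also have "\<dots> = U ^ (card c - 2)"
      using i r_mem fin by (simp add: numeral_2_eq_2)
    finally show "Y * (rise_weight \<alpha> i * (1 + z * p) * (\<Prod>j\<in>c - {i}. step_weight \<alpha> j))
        = Y * (1 + z * p)^2 * U ^ (card c - 2)"
      using step[OF r_mem(1)] i r_only[of i]
      by (simp add: rise_weight_def power2_eq_square mult_ac)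
  qed
  also have "\<dots> = of_nat (card c - 1) * (Y * (1 + z * p)^2 * U ^ (card c - 2))"
    using card_c by simp
  finally have "(\<Sum>i\<in>c. potential (Suc n) (insert_after n i \<alpha>))
      = Y * (z * (1 + z * p) * U ^ (card c - 1)
        + of_nat (card c - 1) * (1 + z * p)^2 * U ^ (card c - 2))"
    using r_mem(2) by (simp add: rise_weight_def algebra_simps)
  also have "\<dots> = y ^ num_cycles n \<alpha> * (C * U ^ card ?o * face_weight (card c))"
  proof -
    have "card c \<noteq> 0" using r_mem fin by auto
    \<comment> \<open>For a singleton the exponent \<open>card c - 2\<close> truncates, but its term
      has the factor 0.\<close>
    then consider "card c = 1" | m where "card c = Suc (Suc m)"
      by (metis One_nat_def not0_implies_Suc)
    then show ?thesis
      by cases (simp_all add: Y_def face_weight_def algebra_simps)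
  qed
  finally show ?thesis .
qed

text \<open>Both sides are affine in the sum \<open>S\<close> of the weights of the other faces. The
  coefficients of \<open>S\<close>, to which merging contributes, agree by
  \<open>\<rho>_rec\<close>; the rest, with the weight of the newly split face, agrees by
  \<open>Q_rec\<close>.\<close>

lemma potential_rec_genus_zero:
  assumes \<alpha>: "\<alpha> permutes {1..n}" and n: "n \<ge> 1" and e: "excess n \<alpha> = 0"
  shows "potential n \<alpha> = x * (\<Sum>i\<in>{1..Suc n}. potential (Suc n) (insert_after n i \<alpha>))"
proof -
  let ?o = "orbit (face_perm n \<alpha>) n" and ?c = "other_cycles (face_perm n \<alpha>) {1..n} n"
  obtain v where v: "is_cycle (face_perm n \<alpha>) (v @ [n])" "set (v @ [n]) = ?o"
    using top_face_cycle[OF \<alpha> n] by metis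
  note vf = face_cycle_facts[OF \<alpha> n v(1)]
  note perm = face_perm_permutation[OF \<alpha> n]
  define s where "s = Suc (length v)"
  have dist: "distinct (v @ [n])" using v(1) by (simp add: is_cycle_def)
  have card_o: "card ?o = s"
    using distinct_card[OF dist] v(2) by (simp add: s_def)
  define S where "S = (\<Sum>c\<in>?c. face_weight (card c))"
  define Y where "Y = y ^ num_cycles n \<alpha>"
  have pot: "potential n \<alpha> = Y * (Q s + \<rho> s * S)"
    using e by (simp add: potential_def Y_def S_def card_o)
  have fixed: "potential (Suc n) (insert_after n (Suc n) \<alpha>) = y * Y * (Q (Suc s) + \<rho> (Suc s) * S)"
  proof -
    have "orbit (face_perm (Suc n) (insert_after n (Suc n) \<alpha>)) (Suc n) = set (v @ [n, Suc n])"
      by (rule is_cycle_orbit[OF is_cycle_insert_fixed[OF \<alpha> n v(1)]]) simp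
    then have "card (orbit (face_perm (Suc n) (insert_after n (Suc n) \<alpha>)) (Suc n)) = Suc s"
      using is_cycle_insert_fixed[OF \<alpha> n v(1)] distinct_card[of "v @ [n, Suc n]"]
      by (simp add: is_cycle_def s_def)
    then show ?thesis
      unfolding potential_def Let_def other_cycles_insert_fixed[OF \<alpha> n v(1)]
      using e excess_insert_fixed[OF \<alpha> n] num_cycles_insert_fixed[OF \<alpha> n]
      by (simp add: S_def Y_def mult_ac)
  qed
  have split: "potential (Suc n) (insert_after n ((v @ [n]) ! t) \<alpha>)
      = Y * (Q (Suc t) + \<rho> (Suc t) * (face_weight (s - t) + S))" if t: "t < s" for t
  proof -
    define i where "i = (v @ [n]) ! t"
    let ?d = "drop (Suc t) (v @ [n])"
    have sp: "v @ [n] = take t v @ i # ?d"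
      using id_take_nth_drop[of t "v @ [n]"] t by (simp add: i_def s_def)
    have "i \<in> set (v @ [n])"
      using t unfolding i_def s_def by (intro nth_mem) simp
    then have i: "i \<in> ?o" "i \<in> {1..n}"
      using v(2) top_face_subset[OF \<alpha> n] by auto
    note cyc = is_cycle_insert_split[OF \<alpha> n v(1) sp]
    have "orbit (face_perm (Suc n) (insert_after n i \<alpha>)) (Suc n) = set (take t v @ [Suc n])"
      by (rule is_cycle_orbit[OF cyc(1)]) simp
    then have 1: "card (orbit (face_perm (Suc n) (insert_after n i \<alpha>)) (Suc n)) = Suc t"
      using cyc(1) distinct_card[of "take t v @ [Suc n]"] t
      by (simp add: is_cycle_def s_def min_def)
    have 2: "card (set (i # ?d)) = s - t"
      using cyc(2) distinct_card[of "i # ?d"] t unfolding is_cycle_def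
      by (simp add: s_def Suc_diff_le del: list.set)
    note oc = other_cycles_insert_split[OF \<alpha> n v(1) sp]
    have "(\<Sum>c\<in>other_cycles (face_perm (Suc n) (insert_after n i \<alpha>)) {1..Suc n} (Suc n).
        face_weight (card c)) = face_weight (s - t) + S"
      unfolding oc(1) S_def sum.insert[OF finite_other_faces[OF \<alpha> n] oc(2)] 2 ..
    then have "potential (Suc n) (insert_after n i \<alpha>)
        = Y * (Q (Suc t) + \<rho> (Suc t) * (face_weight (s - t) + S))"
      using e excess_insert_split[OF \<alpha> n i(1)] num_cycles_insert_after[OF \<alpha> n i(2)] 1
      by (simp add: potential_def Y_def)
    then show ?thesis by (simp add: i_def)
  qed
  have merge: "(\<Sum>i\<in>{1..n} - ?o. potential (Suc n) (insert_after n i \<alpha>)) = Y * (C * U ^ s * S)"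
  proof -
    have orb_sub: "orbit (face_perm n \<alpha>) k \<subseteq> {1..n} - ?o" if "k \<in> {1..n} - ?o" for k
      by (intro orbit_subset_Diff[OF face_perm_permutes[OF \<alpha>]] that) simp
    have "{1..n} - ?o = \<Union>?c"
      using orb_sub permutation_self_in_orbit[OF perm] unfolding other_cycles_def by blast
    then have "(\<Sum>i\<in>{1..n} - ?o. potential (Suc n) (insert_after n i \<alpha>))
        = (\<Sum>i\<in>\<Union>?c. potential (Suc n) (insert_after n i \<alpha>))"
      by simp
    also have "\<dots> = (\<Sum>c\<in>?c. \<Sum>i\<in>c. potential (Suc n) (insert_after n i \<alpha>))"
    proof (rule sum.Union_disjoint[unfolded comp_def])
      show "\<forall>A\<in>?c. finite A"
        using orb_sub finite_subset unfolding other_cycles_def by fastforce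
      show "\<forall>A\<in>?c. \<forall>B\<in>?c. A \<noteq> B \<longrightarrow> A \<inter> B = {}"
        unfolding other_cycles_def using orbit_eq_of_mem[OF perm] by blast
    qed
    also have "\<dots> = (\<Sum>c\<in>?c. Y * (C * U ^ s * face_weight (card c)))"
      by (intro sum.cong refl) (simp add: potential_insert_merge[OF \<alpha> n e] Y_def card_o)
    finally show ?thesis
      by (simp add: S_def sum_distrib_left)
  qed
  have "(\<Sum>i\<in>{1..Suc n}. potential (Suc n) (insert_after n i \<alpha>))
      = y * Y * (Q (Suc s) + \<rho> (Suc s) * S)
        + (\<Sum>t<s. Y * (Q (Suc t) + \<rho> (Suc t) * (face_weight (s - t) + S)))
        + Y * (C * U ^ s * S)"
    unfolding sum_insertions[OF \<alpha> n v(1)] fixed merge s_def[symmetric]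
    using split by simp
  also have "(\<Sum>t<s. Y * (Q (Suc t) + \<rho> (Suc t) * (face_weight (s - t) + S)))
      = Y * (\<Sum>t<s. Q (Suc t) + \<rho> (Suc t) * face_weight (s - t)) + Y * S * (\<Sum>t<s. \<rho> (Suc t))"
    by (simp add: sum_distrib_left sum.distrib[symmetric] algebra_simps)
  finally have "x * (\<Sum>i\<in>{1..Suc n}. potential (Suc n) (insert_after n i \<alpha>))
      = Y * (x * y * Q (Suc s) + x * (\<Sum>t<s. Q (Suc t) + \<rho> (Suc t) * face_weight (s - t)))
        + Y * S * (x * y * \<rho> (Suc s) + x * (\<Sum>t<s. \<rho> (Suc t)) + x * C * U ^ s)"
    by (simp add: algebra_simps)
  also have "\<dots> = Y * Q s + Y * S * \<rho> s"
    using \<rho>_rec[of s] Q_rec[of s] by (simp add: face_weight_def s_def)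
  finally show ?thesis
    by (simp add: pot algebra_simps)
qed

lemma potential_rec:
  assumes \<alpha>: "\<alpha> permutes {1..n}" and n: "n \<ge> 1"
  shows "potential n \<alpha> =
    (if excess n \<alpha> = 2 then y ^ num_cycles n \<alpha> * z ^ card (back_points n \<alpha>) else 0)
    + x * (\<Sum>i\<in>{1..Suc n}. potential (Suc n) (insert_after n i \<alpha>))"
proof -
  consider "excess n \<alpha> = 2" | "excess n \<alpha> = 0" | "excess n \<alpha> > 0" "excess n \<alpha> \<noteq> 2"
    using excess_nonneg[OF \<alpha> n] by linarith
  then show ?thesis
  proof cases
    case 1
    then show ?thesis using potential_rec_genus_one[OF \<alpha> n] by simp
  next
    case 2
    then show ?thesis using potential_rec_genus_zero[OF \<alpha> n] by simp
  next
    case 3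
    \<comment> \<open>Adding 0 or 2 to a positive number other than 2 gives neither 0 nor 2; this
      covers odd values as well.\<close>
    have "potential (Suc n) (insert_after n i \<alpha>) = 0" if i: "i \<in> {1..Suc n}" for i
    proof -
      consider "i = Suc n" | "i \<in> orbit (face_perm n \<alpha>) n" | "i \<in> {1..n} - orbit (face_perm n \<alpha>) n"
        using i by force
      then have "excess (Suc n) (insert_after n i \<alpha>) \<in> {excess n \<alpha>, excess n \<alpha> + 2}"
        by cases (simp_all add: excess_insert_fixed[OF \<alpha> n] excess_insert_split[OF \<alpha> n]
          excess_insert_merge[OF \<alpha> n])
      then show ?thesis using 3 by (auto simp: potential_def)
    qed
    then show ?thesis using 3 by (simp add: potential_def)
  qed
qed

definition genus_one_sum :: "nat \<Rightarrow> 'a" where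
  "genus_one_sum n = (\<Sum>\<alpha> | \<alpha> permutes {1..n} \<and> has_genus n \<alpha> 1.
    y ^ num_cycles n \<alpha> * z ^ card (back_points n \<alpha>))"

lemma sum_potential_rec:
  assumes "n \<ge> 1"
  shows "(\<Sum>\<alpha> | \<alpha> permutes {1..n}. potential n \<alpha>) =
    genus_one_sum n + x * (\<Sum>\<alpha> | \<alpha> permutes {1..Suc n}. potential (Suc n) \<alpha>)"
proof -
  have "(\<Sum>\<alpha> | \<alpha> permutes {1..n}. potential n \<alpha>) = (\<Sum>\<alpha> | \<alpha> permutes {1..n}.
      (if excess n \<alpha> = 2 then y ^ num_cycles n \<alpha> * z ^ card (back_points n \<alpha>) else 0)
      + x * (\<Sum>i\<in>{1..Suc n}. potential (Suc n) (insert_after n i \<alpha>)))"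
    using assms by (intro sum.cong refl potential_rec) auto
  also have "\<dots> = genus_one_sum n + x * (\<Sum>\<alpha> | \<alpha> permutes {1..Suc n}. potential (Suc n) \<alpha>)"
    unfolding sum_permutes_insert_after sum.distrib genus_one_sum_def has_genus_one_iff
    using sum.inter_filter[OF finite_permutations[of "{1..n}"],
        of "\<lambda>\<alpha>. y ^ num_cycles n \<alpha> * z ^ card (back_points n \<alpha>)" "\<lambda>\<alpha>. excess n \<alpha> = 2"]
    by (simp add: sum_distrib_left)
  finally show ?thesis .
qed

lemma sum_potential_one: "(\<Sum>\<alpha> | \<alpha> permutes {1..1}. potential 1 \<alpha>) = y * Q 1"
proof -
  have f: "face_perm (Suc 0) id = id"
    using face_perm_one[of id] permutes_id[of "{1..1}"] by (simp add: One_nat_def)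
  have e: "excess (Suc 0) id = 0"
    using excess_one[of id] permutes_id[of "{1..1}"] by (simp add: One_nat_def)
  have o: "orbit id (Suc 0) = {Suc 0}"
    by (simp add: orbit_eq_singleton_iff)
  have "potential 1 id = y * Q 1"
    by (simp add: potential_def Let_def e f o num_cycles_def other_cycles_def)
  moreover have "{\<alpha>. \<alpha> permutes {1..1::nat}} = {id}"
    by (simp add: permutes_sing)
  ultimately show ?thesis by simp
qed

end

section \<open>Solving the recurrences\<close>

text \<open>Taking differences removes the sum over all smaller arguments. The argument 0 is not the
  length of a face; it supplies the initial condition.\<close>

lemma rec_of_differences:
  fixes f h :: "nat \<Rightarrow> 'a::comm_ring_1"
  assumes "f 0 = x * y * f 1 + h 0"
    and "\<And>s. f (Suc s) - f s = x * y * (f (Suc (Suc s)) - f (Suc s)) + x * f (Suc s)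
      + (h (Suc s) - h s)"
  shows "f s = x * y * f (Suc s) + x * (\<Sum>t<s. f (Suc t)) + h s"
proof (induction s)
  case 0
  then show ?case using assms(1) by simp
next
  case (Suc s)
  have "f (Suc s) = (f (Suc s) - f s) + f s" by simp
  also have "\<dots> = (x * y * (f (Suc (Suc s)) - f (Suc s)) + x * f (Suc s) + (h (Suc s) - h s))
      + (x * y * f (Suc s) + x * (\<Sum>t<s. f (Suc t)) + h s)"
    using assms(2)[of s] Suc by (rule arg_cong2)
  also have "\<dots> = x * y * f (Suc (Suc s)) + x * (\<Sum>t<Suc s. f (Suc t)) + h (Suc s)"
    by (simp add: algebra_simps)
  finally show ?case .
qed

lemma choose_Suc:
  "Suc s choose 2 = s + (s choose 2)" "Suc s choose 3 = (s choose 2) + (s choose 3)"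
  "Suc s choose 4 = (s choose 3) + (s choose 4)"
  by (simp_all add: eval_nat_numeral)

text \<open>
  The kernel equation is equivalent to the quadratic equation for \<open>U\<close>, and \<open>1 - w\<close> turns out to be \<open>U\<close>
  times the square root of \<open>Delta\<close>.
\<close>

locale kernel_root =
  fixes x y p U w C D I :: "'a::idom"
  assumes U_p: "U = 1 + p" and w: "x * y * U^2 = w"
    and kernel: "(1 - x - x * y * U) * p = x"
    and CU: "C * U * (1 - x - x * y * U) = 1"
    and D: "D * (1 - w) = 1" and I: "I * U = 1"
begin

text \<open>As \<open>x + x * p = x * U\<close>, the kernel equation reads
  \<open>x * U = p * (1 - x * y * U)\<close>; multiply by \<open>U\<close>.\<close>

lemma x_U2: "x * U^2 = p * (U - w)"
  using U_p w kernel by algebra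

lemma xC: "x * C = p * I"
proof -
  have "x * C = (1 - x - x * y * U) * p * C * (I * U)"
    unfolding kernel I by simp
  also have "\<dots> = p * I * (C * U * (1 - x - x * y * U))"
    by (simp only: ac_simps)
  finally show ?thesis unfolding CU by simp
qed

lemma U_nonzero: "U \<noteq> 0"
  using I by auto

text \<open>For solutions of the form \<open>U ^ s\<close> times a polynomial with value
  \<open>q\<close> and differences \<open>d\<close>, \<open>dd\<close> at \<open>s\<close>; the
  factor \<open>a\<close> absorbs \<open>U ^ s\<close>. The terms in \<open>q\<close> cancel because
  \<open>x * U^2 = (U - 1) * (U - w)\<close>, so only the differences are constrained.\<close>

lemma step_rec:
  assumes "a * ((1 - w) * d - w * dd) = e"
  shows "a * (U * (q + d) - q) = x * y * (a * (U * (U * (q + d + (d + dd))) - U * (q + d)))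
    + x * (a * (U * (q + d))) + e"
proof -
  have "U * (U * (q + d) - q) = x * y * U^2 * (U * (q + d + (d + dd)) - (q + d))
      + x * U^2 * (q + d) + U * ((1 - w) * d - w * dd)"
    unfolding w x_U2 by (simp add: U_p algebra_simps)
  also have "\<dots> = U * (x * y * (U * (U * (q + d + (d + dd))) - U * (q + d))
      + x * (U * (q + d)) + ((1 - w) * d - w * dd))"
    by (simp add: algebra_simps power2_eq_square)
  finally have "U * (q + d) - q = x * y * (U * (U * (q + d + (d + dd))) - U * (q + d))
      + x * (U * (q + d)) + ((1 - w) * d - w * dd)"
    using U_nonzero by simp
  from arg_cong[OF this, of "\<lambda>t. a * t"] show ?thesis
    unfolding assms[symmetric] by (simp add: algebra_simps)
qed

definition \<rho> :: "nat \<Rightarrow> 'a" where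
  "\<rho> s = p * D * I * (1 + p * of_nat s) * U ^ s"

text \<open>The polynomial \<open>1 + p * s\<close> has differences \<open>p\<close> and 0. Both
  \<open>step_rec\<close> and the case \<open>s = 0\<close> then reduce to
  \<open>p * D * I * (1 - w) = x * C\<close>.\<close>

lemma \<rho>_rec: "\<rho> s = x * y * \<rho> (Suc s) + x * (\<Sum>t<s. \<rho> (Suc t)) + x * C * U ^ s"
proof (rule rec_of_differences)
  have pD: "p * D * I * (1 - w) = x * C"
    using D xC by algebra
  have "p * D * I = x * y * (p * D * I * (1 + p) * U) + x * C"
    using pD w U_p by algebra
  then show "\<rho> 0 = x * y * \<rho> 1 + x * C * U ^ 0"
    by (simp add: \<rho>_def)
  fix s
  have "p * D * I * U ^ s * ((1 - w) * p - w * 0) = x * C * U ^ s * (U - 1)"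
    unfolding pD[symmetric] by (simp add: U_p ac_simps)
  from step_rec[OF this, of "1 + p * of_nat s"]
  show "\<rho> (Suc s) - \<rho> s = x * y * (\<rho> (Suc (Suc s)) - \<rho> (Suc s)) + x * \<rho> (Suc s)
      + (x * C * U ^ Suc s - x * C * U ^ s)"
    unfolding \<rho>_def by (simp add: algebra_simps)
qed

section \<open>The inhomogeneous recurrence for \<open>Q\<close>\<close>

context
  fixes a b :: 'a
begin

definition \<sigma> :: "nat \<Rightarrow> 'a" where
  "\<sigma> s = a * (U * of_nat s + p * of_nat (s choose 2))
    + b * (U * of_nat (s choose 2) + p * of_nat (s choose 3))"

text \<open>A convolution of two linear functions. Passing from \<open>s\<close> to
  \<open>s + 1\<close> adds \<open>b\<close> to each second factor, so the increment is
  \<open>b\<close> times a sum of the first factors, plus the new last term.\<close>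

lemma sum_\<rho>_face: "(\<Sum>t<s. (1 + p * of_nat (Suc t)) * (a + of_nat (s - t - 1) * b)) = \<sigma> s"
proof (induction s)
  case 0
  then show ?case by (simp add: \<sigma>_def binomial_eq_0)
next
  case (Suc s)
  have "(\<Sum>t<s. (1 + p * of_nat (Suc t)) * (a + of_nat (Suc s - t - 1) * b))
      = (\<Sum>t<s. (1 + p * of_nat (Suc t)) * (a + of_nat (s - t - 1) * b)
        + (1 + p * of_nat (Suc t)) * b)"
  proof (intro sum.cong refl)
    fix t assume "t \<in> {..<s}"
    then have "Suc s - t - 1 = Suc (s - t - 1)" by auto
    then show "(1 + p * of_nat (Suc t)) * (a + of_nat (Suc s - t - 1) * b)
        = (1 + p * of_nat (Suc t)) * (a + of_nat (s - t - 1) * b) + (1 + p * of_nat (Suc t)) * b"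
      by (simp add: algebra_simps)
  qed
  also have "\<dots> = \<sigma> s + (\<Sum>t<s. 1 + p * of_nat (Suc t)) * b"
    by (subst sum.distrib) (simp only: Suc.IH sum_distrib_right)
  also have "(\<Sum>t<s. 1 + p * of_nat (Suc t)) = U * of_nat s + p * of_nat (s choose 2)"
  proof (induction s)
    case (Suc s)
    then show ?case by (simp add: choose_Suc U_p algebra_simps)
  qed (simp add: binomial_eq_0)
  finally have eq: "(\<Sum>t<s. (1 + p * of_nat (Suc t)) * (a + of_nat (Suc s - t - 1) * b))
      = \<sigma> s + (U * of_nat s + p * of_nat (s choose 2)) * b" .
  show ?case
    unfolding sum.lessThan_Suc eq \<sigma>_def choose_Suc by (simp add: U_p algebra_simps)
qed

text \<open>
  Coefficients, in the basis \<open>s choose j\<close>, of the polynomial \<open>q\<close> with first and second differences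
  \<open>dq\<close> and \<open>ddq\<close> satisfying \<open>(1 - w) * dq s - w * ddq s = U * \<sigma> (s + 1) - \<sigma> s\<close>; comparing coefficients
  gives a triangular system for \<open>c4, c3, c2, c1\<close>, and \<open>c0\<close> is fixed by the recurrence at \<open>s = 0\<close>.
\<close>

definition "c4 = D * (b * p^2)"
definition "c3 = D * (a * p^2 + 2 * b * p * U + w * c4)"
definition "c2 = D * (2 * a * p * U + b * U^2 + w * c3)"
definition "c1 = D * (a * U^2 + w * c2)"
definition "c0 = w * (U - w) * D^4 * (a * (1 - w) + b * w)"

lemma E_mult: "(1 - w) * (D * q) = q"
  using D by algebra

text \<open>Multiplying by \<open>E^4\<close> clears the powers of \<open>D\<close> in the
  triangular system; the resulting polynomial factors because
  \<open>E * U + w * p = U - w\<close>.\<close>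

lemma c1_eq: "c1 = (U - w)^2 * D^4 * (a * (1 - w) + b * w)"
proof -
  define E where "E = 1 - w"
  have E: "E * (D * q) = q" for q
    unfolding E_def by (rule E_mult)
  have "E^4 * c1 = E^3 * (E * c1)"
    by (simp add: eval_nat_numeral ac_simps)
  also have "\<dots> = E^3 * (a * U^2) + w * (E^2 * (E * c2))"
    unfolding c1_def E by (simp add: eval_nat_numeral algebra_simps)
  also have "\<dots> = E^3 * (a * U^2) + w * (E^2 * (2 * a * p * U + b * U^2) + w * (E * (E * c3)))"
    unfolding c2_def E by (simp add: eval_nat_numeral algebra_simps)
  also have "\<dots> = E^3 * (a * U^2) + w * (E^2 * (2 * a * p * U + b * U^2)
      + w * (E * (a * p^2 + 2 * b * p * U) + w * (b * p^2)))"
    unfolding c3_def E c4_def distrib_left[of E] mult.left_commute[of E w] by simp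
  also have "\<dots> = (E * U + w * p)^2 * (a * E + b * w)"
    by (simp add: eval_nat_numeral algebra_simps)
  also have "E * U + w * p = U - w"
    by (simp add: E_def U_p algebra_simps)
  finally have "E^4 * c1 = (U - w)^2 * (a * E + b * w)" .
  then have "D^4 * E^4 * c1 = (U - w)^2 * D^4 * (a * E + b * w)"
    by (simp only: mult.assoc) (simp only: ac_simps)
  moreover have "D^4 * E^4 = 1"
    using D unfolding E_def by (simp flip: power_mult_distrib)
  ultimately show ?thesis
    unfolding E_def by simp
qed

lemma c0_rec: "U * c0 = w * (c0 + c1)"
  unfolding c1_eq c0_def by (simp add: algebra_simps power2_eq_square)

text \<open>This sum is the value of \<open>q\<close> at 1, which determines
  \<open>Q 1\<close>.\<close>

lemma c0_c1: "c0 + c1 = U * (U - w) * D^4 * (a * (1 - w) + b * w)"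
  unfolding c1_eq c0_def by (simp add: algebra_simps power2_eq_square)

definition q :: "nat \<Rightarrow> 'a" where
  "q s = c0 + c1 * of_nat s + c2 * of_nat (s choose 2) + c3 * of_nat (s choose 3)
    + c4 * of_nat (s choose 4)"

definition dq :: "nat \<Rightarrow> 'a" where
  "dq s = c1 + c2 * of_nat s + c3 * of_nat (s choose 2) + c4 * of_nat (s choose 3)"

definition ddq :: "nat \<Rightarrow> 'a" where
  "ddq s = c2 + c3 * of_nat s + c4 * of_nat (s choose 2)"

lemma q_Suc: "q (Suc s) = q s + dq s" and dq_Suc: "dq (Suc s) = dq s + ddq s"
  by (simp_all add: q_def dq_def ddq_def choose_Suc algebra_simps)

lemma q_rec: "(1 - w) * dq s - w * ddq s = U * \<sigma> (Suc s) - \<sigma> s"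
proof -
  have c: "(1 - w) * c4 = b * p^2" "(1 - w) * c3 = a * p^2 + 2 * b * p * U + w * c4"
    "(1 - w) * c2 = 2 * a * p * U + b * U^2 + w * c3" "(1 - w) * c1 = a * U^2 + w * c2"
    unfolding c4_def c3_def c2_def c1_def E_mult by (rule refl)+
  have "(1 - w) * dq s = (1 - w) * c1 + (1 - w) * c2 * of_nat s
      + (1 - w) * c3 * of_nat (s choose 2) + (1 - w) * c4 * of_nat (s choose 3)"
    unfolding dq_def by (simp only: distrib_left mult.assoc)
  also have "\<dots> - w * ddq s = U * \<sigma> (Suc s) - \<sigma> s"
    unfolding c ddq_def \<sigma>_def choose_Suc
    by (simp add: U_p algebra_simps power2_eq_square)
  finally show ?thesis .
qed

definition Q :: "nat \<Rightarrow> 'a" where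
  "Q s = x * p * D * I * U ^ s * q s"

lemma Q_rec: "Q s = x * y * Q (Suc s) + x * (\<Sum>t<s. Q (Suc t)) + x * p * D * I * U ^ s * \<sigma> s"
proof (rule rec_of_differences)
  have "c0 = x * y * U * (c0 + c1)"
  proof (rule mult_left_cancel[OF U_nonzero, THEN iffD1])
    show "U * c0 = U * (x * y * U * (c0 + c1))"
      using c0_rec w by algebra
  qed
  note c0 = this
  have "Q 0 = x * p * D * I * c0" "Q 1 = x * p * D * I * (U * (c0 + c1))" "\<sigma> 0 = 0"
    by (simp_all add: Q_def q_def \<sigma>_def binomial_eq_0 mult.assoc)
  then show "Q 0 = x * y * Q 1 + x * p * D * I * U ^ 0 * \<sigma> 0"
    by (simp only: mult_zero_right add_0_right) (subst c0, simp only: ac_simps)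
  fix s
  define K where "K = x * p * D * I * U ^ s"
  have "Q s = K * q s" "Q (Suc s) = K * (U * (q s + dq s))"
    "Q (Suc (Suc s)) = K * (U * (U * (q s + dq s + (dq s + ddq s))))"
    unfolding Q_def q_Suc dq_Suc K_def power_Suc by (simp_all only: ac_simps)
  moreover have "K * ((1 - w) * dq s - w * ddq s) = K * U * \<sigma> (Suc s) - K * \<sigma> s"
    unfolding q_rec by (simp only: right_diff_distrib mult.assoc)
  note step_rec[OF this, of "q s"]
  moreover have "x * p * D * I * U ^ Suc s = K * U"
    unfolding K_def power_Suc by (simp only: ac_simps)
  ultimately show "Q (Suc s) - Q s = x * y * (Q (Suc (Suc s)) - Q (Suc s)) + x * Q (Suc s)
      + (x * p * D * I * U ^ Suc s * \<sigma> (Suc s) - x * p * D * I * U ^ s * \<sigma> s)"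
    unfolding K_def[symmetric] by (simp only: right_diff_distrib)
qed

end

end

section \<open>Evaluation at the permutation of {1}\<close>

context kernel_root
begin

text \<open>The weight of a face of length \<open>Suc m\<close> is
  \<open>U ^ m * (a z + m * b z)\<close>. Its product with \<open>\<rho> (Suc t)\<close> thus
  carries \<open>U ^ s\<close> for every \<open>t\<close>, which leaves the sum in
  \<open>sum_\<rho>_face\<close>.\<close>

lemma genus_weights_\<rho>_Q:
  defines "a \<equiv> \<lambda>z. z * U * (1 + z * p)" and "b \<equiv> \<lambda>z. (1 + z * p)^2"
  shows "genus_weights x y z p U C \<rho> (Q (a z) (b z))"
proof
  show "U = 1 + p" "(1 - x - x * y * U) * p = x" "C * U * (1 - x - x * y * U) = 1"
    by (fact U_p kernel CU)+
  show "\<rho> s = x * y * \<rho> (Suc s) + x * (\<Sum>t<s. \<rho> (Suc t)) + x * C * U ^ s" for s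
    by (rule \<rho>_rec)
  fix s :: nat
  let ?F = "\<lambda>m. z * (1 + z * p) * U ^ m + of_nat (m - 1) * (1 + z * p)^2 * U ^ (m - 1)"
  have "\<rho> (Suc t) * ?F (s - t)
      = p * D * I * U ^ s * ((1 + p * of_nat (Suc t)) * (a z + of_nat (s - t - 1) * b z))"
    if t: "t < s" for t
  proof -
    obtain m where m: "s - t = Suc m" "s = Suc t + m"
      using t by (metis Suc_diff_Suc add_Suc_shift le_add_diff_inverse less_imp_le_nat)
    have "?F (s - t) = U ^ m * (a z + of_nat (s - t - 1) * b z)"
      unfolding m(1) a_def b_def by (simp add: algebra_simps)
    then show ?thesis
      unfolding \<rho>_def using m(2) by (simp add: power_add mult_ac)
  qed
  then have "(\<Sum>t<s. \<rho> (Suc t) * ?F (s - t))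
      = p * D * I * U ^ s * (\<Sum>t<s. (1 + p * of_nat (Suc t)) * (a z + of_nat (s - t - 1) * b z))"
    unfolding sum_distrib_left by (intro sum.cong refl) simp
  then have "x * (\<Sum>t<s. \<rho> (Suc t) * ?F (s - t)) = x * p * D * I * U ^ s * \<sigma> (a z) (b z) s"
    unfolding sum_\<rho>_face by (simp add: mult.assoc)
  then show "Q (a z) (b z) s = x * y * Q (a z) (b z) (Suc s)
      + x * (\<Sum>t<s. Q (a z) (b z) (Suc t) + \<rho> (Suc t) * ?F (s - t))"
    unfolding sum.distrib distrib_left using Q_rec[of "a z" "b z" s] by simp
qed

text \<open>\<open>r\<close> will be the square root of \<open>Delta\<close>. By \<open>x_U2\<close>
  and \<open>ab\<close>, all powers of \<open>U\<close> and \<open>D\<close> in \<open>Q 1\<close>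
  combine to \<open>(U * D) ^ 5\<close>, the inverse of \<open>r ^ 5\<close>; this is the origin of
  the exponent 5/2.\<close>

lemma total_weight:
  assumes r: "r * U = 1 - w"
  defines "a \<equiv> \<lambda>z. z * U * (1 + z * p)" and "b \<equiv> \<lambda>z. (1 + z * p)^2"
  shows "x * (y * Q (a z) (b z) 1) * r ^ 5
    = x^3 * y * (x * y + z * (1 - x * y - x) + z^2 * x)"
proof -
  have ab: "a z * (1 - w) + b z * w = U^2 * (x * y + z * (1 - x * y - x) + z^2 * x)"
  proof -
    have "U^2 * (x * y + z * (1 - x * y - x) + z^2 * x)
        = x * y * U^2 + z * (U^2 - x * y * U^2 - x * U^2) + z^2 * (x * U^2)"
      by (simp add: algebra_simps)
    also have "\<dots> = a z * (1 - w) + b z * w"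
      unfolding w x_U2 a_def b_def by (simp add: U_p algebra_simps power2_eq_square)
    finally show ?thesis ..
  qed
  have "Q (a z) (b z) 1 = x * p * D * I * U * (c0 (a z) (b z) + c1 (a z) (b z))"
    by (simp add: Q_def q_def binomial_eq_0)
  also have "\<dots> = x * (p * (U - w)) * (I * U) * U * D ^ 5 * (a z * (1 - w) + b z * w)"
    unfolding c0_c1 by (simp add: eval_nat_numeral ac_simps)
  also have "\<dots> = x * (x * U^2) * U * D ^ 5 * (U^2 * (x * y + z * (1 - x * y - x) + z^2 * x))"
    unfolding x_U2 I ab by simp
  finally have "x * (y * Q (a z) (b z) 1) * r ^ 5
      = x^3 * y * (x * y + z * (1 - x * y - x) + z^2 * x) * (D * (r * U)) ^ 5"
    by (simp add: eval_nat_numeral ac_simps)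
  then show ?thesis
    unfolding r D by simp
qed

end

section \<open>The generating functions\<close>

lemma fps_unit_exists:
  fixes f :: "'a::comm_ring_1 fps"
  assumes "fps_nth f 0 = 1"
  obtains g where "g * f = 1"
proof -
  have "f * fps_right_inverse f 1 = 1"
    using assms by (intro fps_right_inverse) simp
  then show thesis
    using that by (metis mult.commute)
qed

lemma fps_divide_eqI:
  fixes f g h :: "rat fps fps"
  assumes "fps_nth g 0 = 1" "f * g = h"
  shows "f = h / g"
proof -
  have "subdegree g = 0"
    using assms(1) by (simp add: subdegree_eq_0_iff)
  \<comment> \<open>The coefficients lie in \<open>rat fps\<close>, not in a field, so it has to be
    checked that the constant term 1 has inverse 1 there.\<close>
  moreover have "inverse (1 :: rat fps) = 1"
    by (rule fps_inverse_one') simp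
  then have "g * inverse g = 1"
    unfolding fps_inverse_def using assms(1) by (intro fps_right_inverse) simp
  ultimately show ?thesis
    using assms(2) by (simp add: fps_divide_unit' mult.assoc flip: assms(2))
qed

lemma Delta_nth_0: "fps_nth Delta 0 = 1"
  by (simp add: Delta_def var_x_def)

lemma fps_rat_power_nth_0: "fps_nth (fps_rat_power F a) 0 = 1"
  by (simp add: fps_rat_power_def fps_compose_nth)

lemma sqrt_Delta: "fps_rat_power Delta (1/2) ^ 2 = Delta"
  using fps_rat_power_add[OF Delta_nth_0, of "1/2" "1/2"] fps_rat_power_1[OF Delta_nth_0]
  by (simp add: power2_eq_square)

lemma fps_rat_power_Delta_5_2:
  "fps_rat_power Delta (5/2) = fps_rat_power Delta (1/2) ^ 5"
proof -
  have "(5/2 :: rat) = 1/2 + (1/2 + (1/2 + (1/2 + 1/2)))" by simp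
  then show ?thesis
    by (simp only: fps_rat_power_add[OF Delta_nth_0]) (simp add: eval_nat_numeral)
qed

text \<open>The quadratic for \<open>U\<close> has the non-invertible leading coefficient
  \<open>x * y\<close>, so its reciprocal \<open>V\<close>, root of a monic quadratic with
  discriminant \<open>Delta\<close>, is constructed first. The sign of \<open>r\<close> is chosen to
  give \<open>V\<close> the constant term 1.\<close>

lemma kernel_root_exists:
  obtains p U w C D I where "kernel_root var_x var_y p U w C D I"
    "fps_rat_power Delta (1/2) * U = 1 - w"
proof -
  let ?x = var_x and ?y = var_y
  define r where "r = fps_rat_power Delta (1/2)"
  define half :: "rat fps fps" where "half = fps_const (fps_const (1/2))"
  have half: "half + half = 1"
    unfolding half_def by (simp add: fps_const_add flip: fps_const_1_eq_1)
  have r2: "r * r = Delta"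
    using sqrt_Delta by (simp add: r_def power2_eq_square)
  have r0: "fps_nth r 0 = 1"
    by (simp add: r_def fps_rat_power_nth_0)
  have x0: "fps_nth ?x 0 = 0"
    by (simp add: var_x_def)
  define V where "V = half * (1 + ?x * ?y - ?x + r)"
  have V_eq: "V + V = 1 + ?x * ?y - ?x + r"
    unfolding V_def using half by (metis distrib_right mult_1)
  have V0: "fps_nth V 0 = 1"
  proof -
    have "fps_nth V 0 = fps_nth half 0 + fps_nth half 0"
      unfolding V_def by (simp add: r0 x0 algebra_simps)
    also have "\<dots> = 1"
      using half by (metis fps_add_nth fps_one_nth)
    finally show ?thesis .
  qed
  have V_quad: "V * V = (1 + ?x * ?y - ?x) * V - ?x * ?y"
  proof -
    have "4 * (V * V - (1 + ?x * ?y - ?x) * V + ?x * ?y)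
        = (V + V - (1 + ?x * ?y - ?x)) * (V + V - (1 + ?x * ?y - ?x)) - ((1 + ?x * ?y - ?x)^2 - 4 * ?x * ?y)"
      by (simp add: algebra_simps power2_eq_square)
    also have "V + V - (1 + ?x * ?y - ?x) = r"
      using V_eq by simp
    also have "r * r - ((1 + ?x * ?y - ?x)^2 - 4 * ?x * ?y) = 0"
      unfolding r2 Delta_def by (simp add: algebra_simps power2_eq_square)
    finally have *: "4 * (V * V - (1 + ?x * ?y - ?x) * V + ?x * ?y) = 0" .
    have "V * V - (1 + ?x * ?y - ?x) * V + ?x * ?y
        = (half + half) * ((half + half) * (V * V - (1 + ?x * ?y - ?x) * V + ?x * ?y))"
      unfolding half by simp
    also have "\<dots> = half * half * (4 * (V * V - (1 + ?x * ?y - ?x) * V + ?x * ?y))"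
      by (simp add: algebra_simps)
    also have "\<dots> = 0" unfolding * by simp
    finally show ?thesis by (simp add: algebra_simps)
  qed
  obtain U where U: "U * V = 1"
    using fps_unit_exists[OF V0] .
  have U0: "fps_nth U 0 = 1"
    using arg_cong[OF U, of "\<lambda>f. fps_nth f 0"] V0 by simp
  \<comment> \<open>The sum of the roots: their product is \<open>x * y\<close>, so the other root
    is \<open>x * y * U\<close>, and \<open>r\<close> is the difference of the two.\<close>
  have tr: "1 + ?x * ?y - ?x = V + ?x * ?y * U"
  proof -
    have "U * (V * V) = U * ((1 + ?x * ?y - ?x) * V - ?x * ?y)"
      by (simp only: V_quad)
    then have "(U * V) * V = (1 + ?x * ?y - ?x) * (U * V) - ?x * ?y * U"
      by (simp only: algebra_simps)
    then show ?thesis unfolding U by simp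
  qed
  have k: "1 - ?x - ?x * ?y * U = V - ?x * ?y"
    using tr by (simp add: algebra_simps)
  have r_eq: "r = V - ?x * ?y * U"
    using V_eq tr by (simp add: algebra_simps)
  obtain R where R: "R * r = 1"
    using fps_unit_exists[OF r0] .
  have "fps_nth (U * (1 - ?x - ?x * ?y * U)) 0 = 1"
    by (simp add: U0 x0)
  then obtain C where C: "C * (U * (1 - ?x - ?x * ?y * U)) = 1"
    using fps_unit_exists by blast
  define w where "w = ?x * ?y * U^2"
  have rU: "r * U = 1 - w"
  proof -
    have "r * U = U * V - w"
      unfolding r_eq w_def by (simp add: algebra_simps power2_eq_square)
    then show ?thesis unfolding U .
  qed
  \<comment> \<open>\<open>1 - w = r * U\<close> has the inverse \<open>R * V\<close>.\<close>
  have "kernel_root ?x ?y (U - 1) U w C (R * V) V"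
  proof
    show "U = 1 + (U - 1)" "?x * ?y * U^2 = w" "C * U * (1 - ?x - ?x * ?y * U) = 1" "V * U = 1"
      using C U by (simp_all add: w_def mult.assoc mult.commute)
    have "(V - ?x * ?y) * (U - 1) = U * V - (V + ?x * ?y * U) + ?x * ?y"
      by (simp add: algebra_simps)
    also have "\<dots> = ?x"
      unfolding U tr[symmetric] by simp
    finally show "(1 - ?x - ?x * ?y * U) * (U - 1) = ?x"
      unfolding k .
    have "R * V * (r * U) = (R * r) * (U * V)"
      by (simp only: ac_simps)
    then show "R * V * (1 - w) = 1"
      unfolding rU R U by simp
  qed
  then show thesis
    using that rU unfolding r_def by blast
qed

lemma fps_const_sum: "(\<Sum>i\<in>A. fps_const (f i)) = fps_const (sum f A)"
proof (rule fps_ext)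
  fix n
  show "fps_nth (\<Sum>i\<in>A. fps_const (f i)) n = fps_nth (fps_const (sum f A)) n"
    by (cases n) (simp_all add: fps_sum_nth)
qed

lemma fps_nth_telescope:
  fixes T :: "nat \<Rightarrow> 'a::comm_ring_1 fps"
  assumes "\<And>n. n \<ge> 1 \<Longrightarrow> T n = fps_const (c n) + fps_X * T (Suc n)" "n \<ge> 1"
  shows "fps_nth (T n) m = c (n + m)"
  using assms(2)
proof (induction m arbitrary: n)
  case 0
  then show ?case using assms(1)[of n] by simp
next
  case (Suc m)
  then show ?case using assms(1)[of n] by simp
qed

text \<open>
  The variable marking back points is specialised to a rational \<open>t\<close>, which avoids a third power series
  variable; the coefficients are recovered because they are polynomial in \<open>t\<close>.
\<close>

definition genus_one_poly :: "nat \<Rightarrow> nat \<Rightarrow> rat \<Rightarrow> rat" where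
  "genus_one_poly n k t = (\<Sum>\<alpha> | \<alpha> permutes {1..n} \<and> has_genus n \<alpha> 1 \<and> num_cycles n \<alpha> = k.
    t ^ card (back_points n \<alpha>))"

text \<open>The bound \<open>n + 2\<close> exceeds the number of back points and keeps the indices
  0, 1, 2 in range for every \<open>n\<close>.\<close>

lemma genus_one_poly_eq_sum:
  "genus_one_poly n k t = (\<Sum>j\<le>n + 2. of_nat (p_back j n k) * t ^ j)"
proof -
  let ?A = "{\<alpha>. \<alpha> permutes {1..n} \<and> has_genus n \<alpha> 1 \<and> num_cycles n \<alpha> = k}"
  have fin: "finite ?A"
    by (rule finite_subset[OF _ finite_permutations[of "{1..n}"]]) auto
  have "back_points n \<alpha> \<subseteq> {1..n}" for \<alpha>
    by (auto simp: back_points_def)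
  from card_mono[OF _ this] have "card (back_points n \<alpha>) \<le> n" for \<alpha>
    by simp
  then have "(\<lambda>\<alpha>. card (back_points n \<alpha>)) ` ?A \<subseteq> {..n + 2}"
    by (auto intro!: le_SucI)
  then have "genus_one_poly n k t = (\<Sum>j\<le>n + 2. \<Sum>\<alpha> | \<alpha> \<in> ?A \<and> card (back_points n \<alpha>) = j.
      t ^ card (back_points n \<alpha>))"
    unfolding genus_one_poly_def by (intro sum.group[symmetric] fin) auto
  also have "\<dots> = (\<Sum>j\<le>n + 2. of_nat (p_back j n k) * t ^ j)"
    by (intro sum.cong refl) (simp add: p_back_def conj_assoc)
  finally show ?thesis .
qed

lemma p_star_eq: "of_nat (p_star n k) = genus_one_poly n k 1"
  by (simp add: genus_one_poly_def p_star_def)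

lemma num_cycles_positive: "\<alpha> permutes {1..n} \<Longrightarrow> n \<ge> 1 \<Longrightarrow> num_cycles n \<alpha> \<noteq> 0"
  using num_cycles_other_cycles[of \<alpha> n 1] by simp

definition genus_one_gf :: "rat \<Rightarrow> rat fps fps" where
  "genus_one_gf t = Abs_fps (\<lambda>n. Abs_fps (\<lambda>k. if n \<ge> 1 \<and> k \<ge> 1 then genus_one_poly n k t else 0))"

lemma genus_one_gf_eq:
  fixes t :: rat
  defines "z \<equiv> fps_const (fps_const t)"
  shows "genus_one_gf t * fps_rat_power Delta (5/2) = var_x^3 * var_y *
    (var_x * var_y + z * (1 - var_x * var_y - var_x) + z^2 * var_x)"
proof -
  obtain p U w C D I where k: "kernel_root var_x var_y p U w C D I"
    and r: "fps_rat_power Delta (1/2) * U = 1 - w"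
    using kernel_root_exists .
  interpret kernel_root var_x var_y p U w C D I by (rule k)
  let ?Q = "Q (z * U * (1 + z * p)) ((1 + z * p)^2)"
  interpret G: genus_weights var_x var_y z p U C \<rho> ?Q
    by (rule genus_weights_\<rho>_Q)
  define c :: "nat \<Rightarrow> rat fps" where
    "c n = (\<Sum>\<alpha> | \<alpha> permutes {1..n} \<and> has_genus n \<alpha> 1.
      fps_X ^ num_cycles n \<alpha> * fps_const (t ^ card (back_points n \<alpha>)))" for n
  have c: "G.genus_one_sum n = fps_const (c n)" for n
  proof -
    have "var_y ^ k * z ^ b = fps_const (fps_X ^ k * fps_const (t ^ b))" for k b
      by (simp add: var_y_def z_def fps_const_power)
    then show ?thesis
      unfolding G.genus_one_sum_def c_def by (simp only: fps_const_sum)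
  qed
  define T where "T n = (\<Sum>\<alpha> | \<alpha> permutes {1..n}. G.potential n \<alpha>)" for n
  have T_rec: "T n = fps_const (c n) + var_x * T (Suc n)" if "n \<ge> 1" for n
    using G.sum_potential_rec[OF that] unfolding T_def c .
  have T: "fps_nth (T 1) m = c (1 + m)" for m
    by (rule fps_nth_telescope[where T = T, folded var_x_def, OF T_rec]) simp_all
  have c_nth: "fps_nth (c n) k = genus_one_poly n k t" for n k
  proof -
    have "finite {\<alpha>. \<alpha> permutes {1..n} \<and> has_genus n \<alpha> 1}"
      by (rule finite_subset[OF _ finite_permutations[of "{1..n}"]]) auto
    from sum.inter_filter[OF this, of "\<lambda>\<alpha>. t ^ card (back_points n \<alpha>)" "\<lambda>\<alpha>. num_cycles n \<alpha> = k"]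
    moreover have "fps_nth (fps_X ^ m * fps_const s) k = (if m = k then s else 0)" for m and s :: rat
      by (simp add: fps_X_power_nth)
    ultimately show ?thesis
      unfolding c_def genus_one_poly_def fps_sum_nth by (simp add: conj_assoc)
  qed
  \<comment> \<open>The potential counts inserted elements only; the factor \<open>var_x\<close>
    accounts for the initial element 1.\<close>
  have "genus_one_gf t = var_x * T 1"
  proof (rule fps_ext)
    fix n
    show "fps_nth (genus_one_gf t) n = fps_nth (var_x * T 1) n"
    proof (cases n)
      case 0
      then show ?thesis by (simp add: genus_one_gf_def var_x_def fps_eq_iff)
    next
      case (Suc m)
      have "genus_one_poly n 0 t = 0"
      proof -
        have "{\<alpha>. \<alpha> permutes {1..n} \<and> has_genus n \<alpha> 1 \<and> num_cycles n \<alpha> = 0} = {}"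
          using num_cycles_positive[of _ n] Suc by fastforce
        then show ?thesis
          unfolding genus_one_poly_def by (simp only: sum.empty)
      qed
      then have "fps_nth (genus_one_gf t) n = c n"
        unfolding fps_eq_iff c_nth using Suc
        by (auto simp: genus_one_gf_def) (metis One_nat_def Suc_leI neq0_conv)
      then show ?thesis
        using T[of m] Suc by (simp add: var_x_def)
    qed
  qed
  moreover have "T 1 = var_y * ?Q 1"
    unfolding T_def by (rule G.sum_potential_one)
  ultimately show ?thesis
    unfolding fps_rat_power_Delta_5_2 using total_weight[OF r, of z] by simp
qed

lemma sum_atMost_quadratic:
  fixes u0 u1 u2 t :: rat
  shows "(\<Sum>j\<le>n + 2. (if j = 0 then u0 else if j = 1 then u1 else if j = 2 then u2 else 0) * t ^ j)
    = u0 + u1 * t + u2 * t^2"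
proof -
  have "(\<Sum>j\<le>n + 2. (if j = 0 then u0 else if j = 1 then u1 else if j = 2 then u2 else 0) * t ^ j)
      = (\<Sum>j\<in>{0, 1, 2}. (if j = 0 then u0 else if j = 1 then u1 else if j = 2 then u2 else 0) * t ^ j)"
    by (rule sum.mono_neutral_right) auto
  then show ?thesis by simp
qed

lemma polyfun_coeffs_unique:
  fixes a b :: "nat \<Rightarrow> 'a::{idom,ring_char_0}"
  assumes "\<And>t. (\<Sum>j\<le>n. a j * t ^ j) = (\<Sum>j\<le>n. b j * t ^ j)" "i \<le> n"
  shows "a i = b i"
proof -
  have poly: "poly (\<Sum>j\<le>n. monom (d j) j) t = (\<Sum>j\<le>n. d j * t ^ j)" for d :: "nat \<Rightarrow> 'a" and t
    by (simp add: poly_sum poly_monom)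
  have coeff: "coeff (\<Sum>j\<le>n. monom (d j) j) i = d i" for d :: "nat \<Rightarrow> 'a"
    using assms(2) by (simp add: coeff_sum)
  have "(\<Sum>j\<le>n. monom (a j) j) = (\<Sum>j\<le>n. monom (b j) j)"
    using assms(1) by (simp flip: poly_eq_poly_eq_iff add: poly fun_eq_iff)
  then show ?thesis using coeff by metis
qed

theorem theorem6p5:
  shows "bivariate_gf p_star = var_x ^ 3 * var_y / fps_rat_power Delta (5 / 2) \<and>
    bivariate_gf (p_back 0) = var_x ^ 4 * var_y ^ 2 / fps_rat_power Delta (5 / 2) \<and>
    bivariate_gf (p_back 2) = var_x ^ 4 * var_y / fps_rat_power Delta (5 / 2) \<and>
    bivariate_gf (p_back 1) =
      var_x ^ 3 * var_y * (1 - var_x * var_y - var_x) / fps_rat_power Delta (5 / 2)"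
proof -
  let ?r = "fps_rat_power Delta (5/2)"
  obtain R where R: "R * ?r = 1"
    by (rule fps_unit_exists[OF fps_rat_power_nth_0])
  have mult_R: "R * a * ?r = a" for a
  proof -
    have "R * a * ?r = (R * ?r) * a" by (simp only: ac_simps)
    then show ?thesis unfolding R by simp
  qed
  define F0 where "F0 = R * (var_x ^ 4 * var_y ^ 2)"
  define F1 where "F1 = R * (var_x ^ 3 * var_y * (1 - var_x * var_y - var_x))"
  define F2 where "F2 = R * (var_x ^ 4 * var_y)"
  have gf: "genus_one_gf t = F0 + fps_const (fps_const t) * F1 + fps_const (fps_const (t^2)) * F2" for t
  proof -
    have "genus_one_gf t = R * (genus_one_gf t * ?r)"
      using mult_R[of "genus_one_gf t"] by (simp only: ac_simps)
    also have "\<dots> = F0 + fps_const (fps_const t) * F1 + fps_const (fps_const t)^2 * F2"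
      unfolding genus_one_gf_eq F0_def F1_def F2_def
      by (simp add: algebra_simps eval_nat_numeral)
    finally show ?thesis by (simp add: fps_const_power)
  qed
  define u where "u n k j = (if n \<ge> 1 \<and> k \<ge> 1 then of_nat (p_back j n k) else 0 :: rat)" for n k j
  \<comment> \<open>For fixed \<open>n\<close> and \<open>k\<close> both sides are coefficients of
    the same polynomial in \<open>t\<close>.\<close>
  have u: "u n k j = (if j = 0 then fps_nth (fps_nth F0 n) k
      else if j = 1 then fps_nth (fps_nth F1 n) k
      else if j = 2 then fps_nth (fps_nth F2 n) k else 0)" if "j \<le> n + 2" for n k j
  proof (rule polyfun_coeffs_unique[OF _ that])
    fix t :: rat
    have "(\<Sum>j\<le>n + 2. u n k j * t ^ j) = fps_nth (fps_nth (genus_one_gf t) n) k"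
      by (cases "n \<ge> 1 \<and> k \<ge> 1") (auto simp: genus_one_gf_def u_def genus_one_poly_eq_sum)
    also have "\<dots> = fps_nth (fps_nth F0 n) k + fps_nth (fps_nth F1 n) k * t
        + fps_nth (fps_nth F2 n) k * t^2"
      unfolding gf by simp
    finally show "(\<Sum>j\<le>n + 2. u n k j * t ^ j) = (\<Sum>j\<le>n + 2. (if j = 0 then fps_nth (fps_nth F0 n) k
      else if j = 1 then fps_nth (fps_nth F1 n) k
      else if j = 2 then fps_nth (fps_nth F2 n) k else 0) * t ^ j)"
      unfolding sum_atMost_quadratic .
  qed
  have gf_back: "bivariate_gf (p_back 0) = F0" "bivariate_gf (p_back 1) = F1"
    "bivariate_gf (p_back 2) = F2"
    using u[of 0] u[of 1] u[of 2]
    by (auto simp: bivariate_gf_def fps_eq_iff u_def)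
  \<comment> \<open>At \<open>t = 1\<close> back points are forgotten, and the bracket in
    \<open>genus_one_gf_eq\<close> becomes 1.\<close>
  have "bivariate_gf p_star = genus_one_gf 1"
    by (simp add: bivariate_gf_def genus_one_gf_def p_star_eq cong: if_cong)
  then have "bivariate_gf p_star * ?r = var_x ^ 3 * var_y"
    by (simp add: genus_one_gf_eq)
  moreover have "F0 * ?r = var_x ^ 4 * var_y ^ 2" "F2 * ?r = var_x ^ 4 * var_y"
    "F1 * ?r = var_x ^ 3 * var_y * (1 - var_x * var_y - var_x)"
    unfolding F0_def F1_def F2_def by (rule mult_R)+
  ultimately show ?thesis
    unfolding gf_back by (intro conjI fps_divide_eqI fps_rat_power_nth_0)
qed

end
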